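(* Let $G=(V,D,B)$ be a mixed graph and $v\in V$. Let $w_0\to v$ be an edge of $G$, and suppose that the edges $w_1\to v,\dots,w_\ell\to v\in G$ (with $\ell\ge 0$ and $w_0,\dots,w_\ell$ distinct) are generically (respectively, rationally) identifiable. Let $\bar G$ be the subgraph of $G$ obtained by removing the edges $w_0\to v,\dots,w_\ell\to v$. Suppose there are sets $S\subset V\setminus\{v\}$ and $T\subset V\setminus\{v,w_0\}$ with $|S|=|T|+1=k$ such that: (a) $\mathrm{des}(v)\cap(S\cup T\cup\{v\})=\emptyset$; (b) the maximum flow from $S$ to $T'\cup\{w_0'\}$ in $G_{\mathrm{flow}}$ equals $k$; (c) the maximum flow from $S$ to $T'\cup\{v'\}$ in $\bar G_{\mathrm{flow}}$ is smaller than $k$. Then $w_0\to v$ is generically (respectively, rationally) identifiable, by the equation $$\lambda_{w_0v}=\frac{|\Sigma_{S,T\cup\{v\}}|-\sum_{i=1}^{\ell}\lambda_{w_iv}|\Sigma_{S,T\cup\{w_i\}}|}{|\Sigma_{S,T\cup\{w_0\}}|},$$ where $\Sigma=\phi_G(\Lambda,\Omega)$ and $|\cdot|$ denotes the determinant (rows and columns ordered compatibly).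
   Context: A mixed graph $G=(V,D,B)$ on $V=\{1,\dots,n\}$ has directed edges $D\subset V\times V$ ($v\to w\in G$ iff $(v,w)\in D$) and symmetric bidirected edges $B$ ($v\leftrightarrow w\in G$ iff $(v,w)\in B$), no self-loops. $\mathrm{des}(v)$ is the set of $w$ such that there is a non-empty directed path $v\to\cdots\to w$ in $G$ (so $v\in\mathrm{des}(v)$ iff $v$ lies on a directed cycle). $\mathbb{R}^D_{\mathrm{reg}}$ is the set of real $n\times n$ matrices $\Lambda$ with $\lambda_{vw}=0$ unless $v\to w\in G$ and with $I-\Lambda$ invertible; $PD(B)$ is the set of positive definite $n\times n$ matrices $\Omega$ with $\omega_{vw}=0$ for $v\neq w$ unless $v\leftrightarrow w\in G$. Let $\Theta=\mathbb{R}^D_{\mathrm{reg}}\times PD(B)$ and $\phi_G(\Lambda,\Omega)=(I-\Lambda)^{-T}\Omega(I-\Lambda)^{-1}$. An edge $u\to w$ is generically identifiable if there is a proper algebraic subset $A\subset\Theta$ such that for all $(\Lambda,\Omega)\in\Theta\setminus A$, every $(\tilde\Lambda,\tilde\Omega)\in\Theta$ with $\phi_G(\tilde\Lambda,\tilde\Omega)=\phi_G(\Lambda,\Omega)$ satisfies $\tilde\lambda_{uw}=\lambda_{uw}$; it is rationally identifiable if there is a rational function $\psi$ and a proper algebraic subset $A\subset\Theta$ with $\psi(\phi_G(\Lambda,\Omega))=\lambda_{uw}$ for all $(\Lambda,\Omega)\in\Theta\setminus A$. For a mixed graph $H$ on $V$, $H_{\mathrm{flow}}$ is the directed graph on $\{1,\dots,n\}\cup\{1',\dots,n'\}$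 with edges $i\to j$ whenever $j\to i\in H$, $i\to i'$ for all $i$, $i\to j'$ whenever $i\leftrightarrow j\in H$, and $i'\to j'$ whenever $i\to j\in H$, with all vertices and edges of capacity $1$; for $T\subset V$, $T'=\{t':t\in T\}$. Maximum flows are with multiple sources/sinks and vertex capacities. *)

theory Defs
  imports "HOL-Analysis.Analysis"
begin

text \<open>Vertices are the elements of a finite type 'n (playing the role of V = {1..n}).
  A mixed graph is given by a set D of directed edges (v,w) meaning v -> w and a
  set B of bidirected edges (symmetric), without self-loops.\<close>

definition mixed_graph :: "('n \<times> 'n) set \<Rightarrow> ('n \<times> 'n) set \<Rightarrow> bool" where
  "mixed_graph D B \<longleftrightarrow> sym B \<and> (\<forall>x. (x, x) \<notin> D) \<and> (\<forall>x. (x, x) \<notin> B)"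

definition des :: "('n \<times> 'n) set \<Rightarrow> 'n \<Rightarrow> 'n set" where
  "des D v = {w. (v, w) \<in> D\<^sup>+}"

definition RDreg :: "('n::finite \<times> 'n) set \<Rightarrow> (real^'n^'n) set" where
  "RDreg D = {L. (\<forall>v w. (v, w) \<notin> D \<longrightarrow> L $ v $ w = 0) \<and> invertible (mat 1 - L)}"

definition pos_def :: "real^'n^'n \<Rightarrow> bool" where
  "pos_def M \<longleftrightarrow> transpose M = M \<and> (\<forall>x. x \<noteq> 0 \<longrightarrow> x \<bullet> (M *v x) > 0)"

definition PDB :: "('n::finite \<times> 'n) set \<Rightarrow> (real^'n^'n) set" where
  "PDB B = {Om. pos_def Om \<and> (\<forall>v w. v \<noteq> w \<and> (v, w) \<notin> B \<longrightarrow> Om $ v $ w = 0)}"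

definition Theta :: "('n::finite \<times> 'n) set \<Rightarrow> ('n \<times> 'n) set \<Rightarrow> ((real^'n^'n) \<times> (real^'n^'n)) set" where
  "Theta D B = RDreg D \<times> PDB B"

definition phi :: "real^'n::finite^'n \<Rightarrow> real^'n^'n \<Rightarrow> real^'n^'n" where
  "phi L Om = transpose (matrix_inv (mat 1 - L)) ** Om ** matrix_inv (mat 1 - L)"

inductive_set polyfun :: "('a \<Rightarrow> real) set \<Rightarrow> ('a \<Rightarrow> real) set" for C where
  const: "(\<lambda>_. c) \<in> polyfun C"
| coord: "f \<in> C \<Longrightarrow> f \<in> polyfun C"
| add: "f \<in> polyfun C \<Longrightarrow> g \<in> polyfun C \<Longrightarrow> (\<lambda>x. f x + g x) \<in> polyfun C"
| mult: "f \<in> polyfun C \<Longrightarrow> g \<in> polyfun C \<Longrightarrow> (\<lambda>x. f x * g x) \<in> polyfun C"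

definition par_coords :: "((real^'n::finite^'n) \<times> (real^'n^'n) \<Rightarrow> real) set" where
  "par_coords = {(\<lambda>\<theta>. fst \<theta> $ i $ j) | i j. True} \<union> {(\<lambda>\<theta>. snd \<theta> $ i $ j) | i j. True}"

definition mat_coords :: "(real^'n::finite^'n \<Rightarrow> real) set" where
  "mat_coords = {(\<lambda>M. M $ i $ j) | i j. True}"

definition proper_alg_subset ::
    "('n::finite \<times> 'n) set \<Rightarrow> ('n \<times> 'n) set \<Rightarrow> ((real^'n^'n) \<times> (real^'n^'n)) set \<Rightarrow> bool" where
  "proper_alg_subset D B A \<longleftrightarrow>
     (\<exists>P. P \<subseteq> polyfun par_coords \<and> A = {\<theta> \<in> Theta D B. \<forall>p\<in>P. p \<theta> = 0})
     \<and> A \<noteq> Theta D B"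

definition generically_identifiable :: "('n::finite \<times> 'n) set \<Rightarrow> ('n \<times> 'n) set \<Rightarrow> 'n \<Rightarrow> 'n \<Rightarrow> bool" where
  "generically_identifiable D B u w \<longleftrightarrow>
     (\<exists>A. proper_alg_subset D B A \<and>
        (\<forall>L Om L' Om'. (L, Om) \<in> Theta D B - A \<longrightarrow> (L', Om') \<in> Theta D B \<longrightarrow>
            phi L' Om' = phi L Om \<longrightarrow> L' $ u $ w = L $ u $ w))"

definition rationally_identifiable :: "('n::finite \<times> 'n) set \<Rightarrow> ('n \<times> 'n) set \<Rightarrow> 'n \<Rightarrow> 'n \<Rightarrow> bool" where
  "rationally_identifiable D B u w \<longleftrightarrow>
     (\<exists>p q A. p \<in> polyfun mat_coords \<and> q \<in> polyfun mat_coords \<and> proper_alg_subset D B A \<and>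
        (\<forall>L Om. (L, Om) \<in> Theta D B - A \<longrightarrow>
            q (phi L Om) \<noteq> 0 \<and> p (phi L Om) / q (phi L Om) = L $ u $ w))"

text \<open>H_flow on V + V': Inl i is i, Inr i is i'.\<close>
definition flow_graph :: "('n \<times> 'n) set \<Rightarrow> ('n \<times> 'n) set \<Rightarrow> ('n + 'n) \<Rightarrow> ('n + 'n) \<Rightarrow> bool" where
  "flow_graph D B x y \<longleftrightarrow>
     (\<exists>i j. x = Inl i \<and> y = Inl j \<and> (j, i) \<in> D) \<or>
     (\<exists>i. x = Inl i \<and> y = Inr i) \<or>
     (\<exists>i j. x = Inl i \<and> y = Inr j \<and> (i, j) \<in> B) \<or>
     (\<exists>i j. x = Inr i \<and> y = Inr j \<and> (i, j) \<in> D)"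

text \<open>A flow from sources S to sinks T in the digraph E with all edge and vertex capacities 1
  (multiple sources/sinks via a super-source feeding a x into source x and a super-sink
  receiving b x from sink x): f is the flow on edges.\<close>
definition is_unit_flow :: "('v::finite \<Rightarrow> 'v \<Rightarrow> bool) \<Rightarrow> 'v set \<Rightarrow> 'v set \<Rightarrow>
    ('v \<Rightarrow> 'v \<Rightarrow> real) \<Rightarrow> ('v \<Rightarrow> real) \<Rightarrow> ('v \<Rightarrow> real) \<Rightarrow> bool" where
  "is_unit_flow E S T f a b \<longleftrightarrow>
     (\<forall>x y. 0 \<le> f x y \<and> f x y \<le> 1 \<and> (\<not> E x y \<longrightarrow> f x y = 0)) \<and>
     (\<forall>x. 0 \<le> a x \<and> a x \<le> 1 \<and> (x \<notin> S \<longrightarrow> a x = 0)) \<and>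
     (\<forall>x. 0 \<le> b x \<and> b x \<le> 1 \<and> (x \<notin> T \<longrightarrow> b x = 0)) \<and>
     (\<forall>x. a x + (\<Sum>y\<in>UNIV. f y x) = b x + (\<Sum>y\<in>UNIV. f x y)) \<and>
     (\<forall>x. a x + (\<Sum>y\<in>UNIV. f y x) \<le> 1)"

definition max_flow :: "('v::finite \<Rightarrow> 'v \<Rightarrow> bool) \<Rightarrow> 'v set \<Rightarrow> 'v set \<Rightarrow> real" where
  "max_flow E S T = Sup {(\<Sum>x\<in>UNIV. a x) | f a b. is_unit_flow E S T f a b}"

definition minor :: "real^'n^'n \<Rightarrow> 'n list \<Rightarrow> 'n list \<Rightarrow> real" where
  "minor M rs cs =
     (\<Sum>p | p permutes {..<length rs}. of_int (sign p) * (\<Prod>i<length rs. M $ (rs ! i) $ (cs ! p i)))"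

end

theory Submission
  imports Defs "Jordan_Normal_Form.Determinant"
begin

text \<open>
  Let \<^term>\<open>L'\<close> arise from \<^term>\<open>L\<close> by deleting the coefficients of the removed edges into \<^term>\<open>v\<close>.
  As \<^term>\<open>v\<close> lies on no cycle, the matrix \<open>(I - L')\<^sup>-\<^sup>1\<close> is a rank-one update of \<open>(I - L)\<^sup>-\<^sup>1\<close>, and outside
  the descendants of \<^term>\<open>v\<close> it changes only the column of \<^term>\<open>v\<close>, from which the combination of the columns
  of the parents is subtracted.  So the claimed equation says that the minor of \<open>\<phi>(L', \<Omega>)\<close> on
  \<open>S \<times> (T \<union> {v})\<close> vanishes.

  Vanishing and flows are linked without Menger's theorem.  The matrix \<open>\<phi>(L, \<Omega>)\<close> is a block of the inverse
  of \<open>I - W\<close> with \<open>W\<close> supported on the edges of the flow graph.  Replacing the rows of the sinks of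
  \<open>I - W\<close> by unit vectors at the sources gives a matrix that is nonsingular if the minor is nonzero, and a
  nonzero term of its Leibniz expansion is a flow of full value.  Conversely, a real flow of
  value above \<open>k - 1\<close> yields such a term by Hall's theorem; it splits into path systems in the two copies of
  the graph and a matching between them.  Choosing \<open>\<Omega> = H\<^sup>T H + \<epsilon> I\<close> decouples the two path systems, because
  for \<open>\<epsilon> = 0\<close> the minor is a product of two minors of \<open>H (I - L)\<^sup>-\<^sup>1\<close>, each of which can be made nonzero
  separately and hence, both being rational functions of \<open>(L, H)\<close>, simultaneously.
\<close>

section \<open>Minors\<close>

no_notation Matrix.vec_index (infixl \<open>$\<close> 100)
no_notation Matrix.scalar_prod (infix \<open>\<bullet>\<close> 70)
hide_const (open) Matrix.mat Matrix.vec Determinant.det Matrix.row Matrix.rows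
  Matrix.col Matrix.cols Determinant.cofactor

text \<open>Links \<open>minor\<close> to determinants of matrices whose dimension is a number, for
  which the kernel criterion and the transposition rule can be cited.\<close>

lemma minor_eq_det:
  fixes M :: "real^'n^'n"
  assumes "length rs = k" "length cs = k"
  shows "minor M rs cs = Determinant.det (Matrix.mat k k (\<lambda>(i, j). M $ (rs ! i) $ (cs ! j)))"
proof -
  have "(\<Prod>i<k. M $ (rs ! i) $ (cs ! p i)) =
      (\<Prod>i = 0..<k. Matrix.mat k k (\<lambda>(i, j). M $ (rs ! i) $ (cs ! j)) $$ (i, p i))"
    if "p permutes {0..<k}" for p
    unfolding atLeast0LessThan
  proof (intro prod.cong refl)
    fix i assume "i \<in> {..<k}"
    moreover from this have "p i < k" using permutes_in_image[OF that, of i] by simp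
    ultimately show "M $ (rs ! i) $ (cs ! p i) = Matrix.mat k k (\<lambda>(i, j). M $ (rs ! i) $ (cs ! j)) $$ (i, p i)"
      by simp
  qed
  then show ?thesis
    unfolding minor_def det_def'[OF mat_carrier] assms(1)
    by (intro sum.cong) (simp_all add: atLeast0LessThan)
qed

lemma sum_distinct_list_nth:
  assumes "distinct xs"
  shows "(\<Sum>i<length xs. f (xs ! i)) = (\<Sum>x\<in>set xs. f x)"
  by (rule sum.reindex_bij_betw[OF bij_betw_nth[OF assms]]) auto

text \<open>A square matrix is singular exactly if some nonzero vector lies in its kernel. The
  kernel vector is a function on vertices instead of list positions, so that later arguments work
  with vectors over \<open>'n\<close> and can ignore orderings.\<close>

lemma minor_nonzero_iff:
  fixes M :: "real^'n^'n"
  assumes cs: "distinct cs" and len: "length rs = length cs"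
  shows "minor M rs cs \<noteq> 0 \<longleftrightarrow>
    (\<forall>y :: 'n \<Rightarrow> real. (\<forall>r\<in>set rs. (\<Sum>c\<in>set cs. M $ r $ c * y c) = 0) \<longrightarrow> (\<forall>c\<in>set cs. y c = 0))"
proof -
  define k where "k = length cs"
  let ?A = "Matrix.mat k k (\<lambda>(i, j). M $ (rs ! i) $ (cs ! j))"
  have A: "?A \<in> carrier_mat k k" by simp
  have zero: "u = 0\<^sub>v k \<longleftrightarrow> (\<forall>i<k. vec_index u i = 0)" if "u \<in> carrier_vec k" for u :: "real Matrix.vec"
    using that by (auto intro!: eq_vecI)
  have prod: "?A *\<^sub>v u = 0\<^sub>v k \<longleftrightarrow> (\<forall>i<k. (\<Sum>j<k. M $ (rs ! i) $ (cs ! j) * vec_index u j) = 0)"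
    if "u \<in> carrier_vec k" for u
    using that by (subst zero[OF mult_mat_vec_carrier[OF A that]]) (auto simp: scalar_prod_def atLeast0LessThan)
  have rows: "(\<forall>r\<in>set rs. P r) \<longleftrightarrow> (\<forall>i<k. P (rs ! i))" for P
    using len by (metis in_set_conv_nth k_def)
  have cols: "(\<forall>c\<in>set cs. P c) \<longleftrightarrow> (\<forall>i<k. P (cs ! i))" for P
    by (metis in_set_conv_nth k_def)
  have sums: "(\<Sum>c\<in>set cs. M $ r $ c * y c) = (\<Sum>j<k. M $ r $ (cs ! j) * y (cs ! j))" for r and y :: "'n \<Rightarrow> real"
    using sum_distinct_list_nth[OF cs, of "\<lambda>c. M $ r $ c * y c"] by (simp add: k_def)
  have "minor M rs cs = 0 \<longleftrightarrow>
      (\<exists>u. u \<in> carrier_vec k \<and> u \<noteq> 0\<^sub>v k \<and> ?A *\<^sub>v u = 0\<^sub>v k)"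
    unfolding minor_eq_det[OF len[folded k_def] k_def[symmetric]]
    by (rule det_0_iff_vec_prod_zero_field[OF A])
  also have "\<dots> \<longleftrightarrow> (\<exists>y :: 'n \<Rightarrow> real.
      (\<forall>r\<in>set rs. (\<Sum>c\<in>set cs. M $ r $ c * y c) = 0) \<and> \<not> (\<forall>c\<in>set cs. y c = 0))"
    (is "?L \<longleftrightarrow> ?R")
  proof
    assume ?L
    then obtain u where u: "u \<in> carrier_vec k" "u \<noteq> 0\<^sub>v k" "?A *\<^sub>v u = 0\<^sub>v k" by blast
    \<comment> \<open>The kernel vector is carried from list positions to vertices by inverting the
      enumeration \<open>cs\<close>.\<close>
    define y where "y c = vec_index u (the_inv_into {..<k} ((!) cs) c)" for c
    have y: "y (cs ! j) = vec_index u j" if "j < k" for j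
      using the_inv_into_f_f[OF inj_on_nth[OF cs, of "{..<k}"], of j] that by (simp add: y_def k_def)
    have "\<forall>i<k. (\<Sum>j<k. M $ (rs ! i) $ (cs ! j) * y (cs ! j)) = 0"
      using prod[OF u(1)] u(3) y by simp
    moreover have "\<exists>j<k. y (cs ! j) \<noteq> 0"
      using u(1,2) y by (auto simp: zero)
    ultimately show ?R
      by (intro exI[of _ y]) (auto simp: rows cols sums)
  next
    assume ?R
    then obtain y :: "'n \<Rightarrow> real" where y: "\<forall>i<k. (\<Sum>j<k. M $ (rs ! i) $ (cs ! j) * y (cs ! j)) = 0"
       "\<exists>j<k. y (cs ! j) \<noteq> 0" by (auto simp: rows cols sums)
    show ?L
      by (rule exI[of _ "Matrix.vec k (\<lambda>j. y (cs ! j))"])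
        (use y in \<open>auto simp: prod zero\<close>)
  qed
  finally show ?thesis by blast
qed

lemma minor_transpose:
  fixes M :: "real^'n^'n"
  assumes "length rs = length cs"
  shows "minor (transpose M) cs rs = minor M rs cs"
proof -
  let ?A = "Matrix.mat (length rs) (length rs) (\<lambda>(i, j). M $ (rs ! i) $ (cs ! j))"
  have "minor (transpose M) cs rs = Determinant.det (transpose_mat ?A)"
    using assms by (subst minor_eq_det[where k = "length rs"])
      (auto intro!: arg_cong[where f = Determinant.det] simp: transpose_def)
  also have "\<dots> = minor M rs cs"
    using assms by (subst det_transpose[where n = "length rs"]) (auto simp: minor_eq_det)
  finally show ?thesis .
qed

lemma minor_nonzero_iff_left:
  fixes M :: "real^'n^'n"
  assumes rs: "distinct rs" and len: "length rs = length cs"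
  shows "minor M rs cs \<noteq> 0 \<longleftrightarrow>
    (\<forall>y :: 'n \<Rightarrow> real. (\<forall>c\<in>set cs. (\<Sum>r\<in>set rs. y r * M $ r $ c) = 0) \<longrightarrow> (\<forall>r\<in>set rs. y r = 0))"
  using minor_nonzero_iff[OF rs, of cs "transpose M"] minor_transpose[OF len, of M] len
  by (simp add: transpose_def mult.commute)

text \<open>In each Leibniz term the row matched with the last column is the preimage of
  \<open>length cs\<close>. Isolating its factor makes linearity in that column visible.\<close>

lemma minor_last_column_expand:
  fixes M :: "real^'n^'n"
  assumes "length rs = Suc (length cs)"
  shows "minor M rs (cs @ [c]) =
    (\<Sum>p | p permutes {..<length rs}. of_int (sign p) * (M $ (rs ! Hilbert_Choice.inv p (length cs)) $ c *
       (\<Prod>i\<in>{..<length rs} - {Hilbert_Choice.inv p (length cs)}. M $ (rs ! i) $ (cs ! p i))))"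
  unfolding minor_def
proof (intro sum.cong refl, clarsimp)
  fix p assume p: "p permutes {..<length rs}"
  let ?m = "Hilbert_Choice.inv p (length cs)"
  have m: "?m \<in> {..<length rs}"
    using permutes_in_image[OF permutes_inv[OF p], of "length cs"] assms by simp
  have pm: "p ?m = length cs" using p by (simp add: permutes_inverses)
  have rest: "p i < length cs" if "i \<in> {..<length rs} - {?m}" for i
  proof -
    have "p i \<noteq> length cs" using that p by (metis DiffE insertI1 permutes_inverses(2))
    moreover have "p i < length rs" using that permutes_in_image[OF p, of i] by simp
    ultimately show ?thesis using assms by simp
  qed
  show "(\<Prod>i<length rs. M $ (rs ! i) $ ((cs @ [c]) ! p i)) = M $ (rs ! ?m) $ c *
      (\<Prod>i\<in>{..<length rs} - {?m}. M $ (rs ! i) $ (cs ! p i))"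
    unfolding prod.remove[OF finite_lessThan m] using rest
    by (intro arg_cong2[where f = "(*)"] prod.cong) (simp_all add: pm nth_append)
qed

text \<open>Linearity of the determinant in one column. It is meant for the column of
  \<open>v\<close>, which turns into a combination of other columns when edges into \<open>v\<close>
  are removed.\<close>

lemma minor_last_column_linear:
  fixes M M' :: "real^'n^'n"
  assumes len: "length rs = Suc (length cs)"
    and same: "\<And>r x. r \<in> set rs \<Longrightarrow> x \<in> set cs \<Longrightarrow> M' $ r $ x = M $ r $ x"
    and lin: "\<And>r. r \<in> set rs \<Longrightarrow> M' $ r $ c = (\<Sum>j\<in>J. a j * M $ r $ d j)"
  shows "minor M' rs (cs @ [c]) = (\<Sum>j\<in>J. a j * minor M rs (cs @ [d j]))"
proof -
  let ?P = "{p. p permutes {..<length rs}}"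
  let ?m = "\<lambda>p. Hilbert_Choice.inv p (length cs)"
  let ?R = "\<lambda>M p. \<Prod>i\<in>{..<length rs} - {?m p}. M $ (rs ! i) $ (cs ! p i)"
  have m: "?m p < length rs" if "p permutes {..<length rs}" for p
    using permutes_in_image[OF permutes_inv[OF that], of "length cs"] len by simp
  have rest: "p i < length cs" if "p permutes {..<length rs}" "i \<in> {..<length rs} - {?m p}" for p i
  proof -
    have "p i \<noteq> length cs" using that by (metis DiffE insertI1 permutes_inverses(2))
    moreover have "p i < length rs" using that permutes_in_image[OF that(1), of i] by simp
    ultimately show ?thesis using len by simp
  qed
  have R: "?R M' p = ?R M p" if "p permutes {..<length rs}" for p
    using rest[OF that] by (intro prod.cong same) auto
  have "minor M' rs (cs @ [c]) =
      (\<Sum>p\<in>?P. \<Sum>j\<in>J. of_int (sign p) * (a j * M $ (rs ! ?m p) $ d j * ?R M p))"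
    unfolding minor_last_column_expand[OF len]
    by (intro sum.cong) (auto simp: R m lin sum_distrib_left sum_distrib_right)
  also have "\<dots> = (\<Sum>j\<in>J. a j * minor M rs (cs @ [d j]))"
    unfolding minor_last_column_expand[OF len]
    by (subst sum.swap) (simp add: sum_distrib_left mult_ac)
  finally show ?thesis .
qed

section \<open>Rational functions on the parameter space\<close>

lemma polyfun_sum:
  "(\<And>i. i \<in> I \<Longrightarrow> (\<lambda>x. f i x) \<in> polyfun C) \<Longrightarrow> (\<lambda>x. \<Sum>i\<in>I. f i x) \<in> polyfun C"
  by (induction I rule: infinite_finite_induct) (auto intro: polyfun.intros)

lemma polyfun_prod:
  "(\<And>i. i \<in> I \<Longrightarrow> (\<lambda>x. f i x) \<in> polyfun C) \<Longrightarrow> (\<lambda>x. \<Prod>i\<in>I. f i x) \<in> polyfun C"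
  by (induction I rule: infinite_finite_induct) (auto intro: polyfun.intros)

lemma polyfun_power: "f \<in> polyfun C \<Longrightarrow> (\<lambda>x. f x ^ n) \<in> polyfun C"
  by (induction n) (auto intro: polyfun.intros)

lemma polyfun_diff:
  assumes "f \<in> polyfun C" "g \<in> polyfun C"
  shows "(\<lambda>x. f x - g x) \<in> polyfun C"
  using polyfun.add[OF assms(1) polyfun.mult[OF polyfun.const[of "-1"] assms(2)]] by simp

lemma polyfun_det:
  fixes A :: "'a \<Rightarrow> real^'n^'n"
  assumes "\<And>i j. (\<lambda>x. A x $ i $ j) \<in> polyfun C"
  shows "(\<lambda>x. det (A x)) \<in> polyfun C"
  unfolding Determinants.det_def by (intro polyfun_sum polyfun.mult polyfun_prod polyfun.const assms)

lemma polyfun_minor: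
  "(\<lambda>M :: real^'n::finite^'n. minor M rs cs) \<in> polyfun mat_coords"
  unfolding minor_def
  by (intro polyfun_sum polyfun.mult polyfun_prod polyfun.const polyfun.coord)
     (auto simp: mat_coords_def)

lemma polyfun_fst: "(\<lambda>\<theta> :: (real^'n::finite^'n) \<times> (real^'n^'n). fst \<theta> $ i $ j) \<in> polyfun par_coords"
  and polyfun_snd: "(\<lambda>\<theta> :: (real^'n::finite^'n) \<times> (real^'n^'n). snd \<theta> $ i $ j) \<in> polyfun par_coords"
  by (rule polyfun.coord; auto simp: par_coords_def)+

section \<open>Rational functions whose denominator is a power of det(I - L)\<close>

definition reg_det :: "(real^'n::finite^'n) \<times> (real^'n^'n) \<Rightarrow> real" where
  "reg_det \<theta> = det (mat 1 - fst \<theta>)"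

lemma polyfun_I_minus_fst:
  "(\<lambda>\<theta> :: (real^'n::finite^'n) \<times> (real^'n^'n). (mat 1 - fst \<theta>) $ i $ j) \<in> polyfun par_coords"
  by (simp, intro polyfun_diff polyfun_fst polyfun.const)

lemma polyfun_reg_det: "reg_det \<in> polyfun par_coords"
  using polyfun_det[of "\<lambda>\<theta>. mat 1 - fst \<theta>", OF polyfun_I_minus_fst]
  by (simp add: reg_det_def[abs_def])

text \<open>The localization of the polynomials at \<open>reg_det\<close>. Values where
  \<open>reg_det\<close> vanishes are left free, since \<open>matrix_inv\<close> carries no
  information there.\<close>

definition regular_funs :: "((real^'n::finite^'n) \<times> (real^'n^'n) \<Rightarrow> real) set" where
  "regular_funs = {f. \<exists>N. \<exists>g\<in>polyfun par_coords. \<forall>\<theta>. reg_det \<theta> \<noteq> 0 \<longrightarrow> reg_det \<theta> ^ N * f \<theta> = g \<theta>}"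

lemma regular_funsI:
  assumes "g \<in> polyfun par_coords" "\<And>\<theta>. reg_det \<theta> \<noteq> 0 \<Longrightarrow> reg_det \<theta> ^ N * f \<theta> = g \<theta>"
  shows "f \<in> regular_funs"
  unfolding regular_funs_def using assms by (intro CollectI exI[of _ N] bexI[of _ g]) auto

lemma regular_funsE:
  assumes "f \<in> regular_funs"
  obtains N g where "g \<in> polyfun par_coords" "\<And>\<theta>. reg_det \<theta> \<noteq> 0 \<Longrightarrow> reg_det \<theta> ^ N * f \<theta> = g \<theta>"
  using assms by (auto simp: regular_funs_def)

lemma regular_polyfun: "f \<in> polyfun par_coords \<Longrightarrow> f \<in> regular_funs"
  by (rule regular_funsI[where N = 0]) auto

lemma regular_mult:
  fixes f f' :: "(real^'n::finite^'n) \<times> (real^'n^'n) \<Rightarrow> real"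
  assumes "f \<in> regular_funs" "f' \<in> regular_funs"
  shows "(\<lambda>\<theta>. f \<theta> * f' \<theta>) \<in> regular_funs"
proof -
  obtain N g where
    g: "g \<in> polyfun par_coords" "\<And>\<theta>. reg_det \<theta> \<noteq> 0 \<Longrightarrow> reg_det \<theta> ^ N * f \<theta> = g \<theta>"
    using regular_funsE[OF assms(1)] by metis
  obtain N' g' where
    g': "g' \<in> polyfun par_coords" "\<And>\<theta>. reg_det \<theta> \<noteq> 0 \<Longrightarrow> reg_det \<theta> ^ N' * f' \<theta> = g' \<theta>"
    using regular_funsE[OF assms(2)] by metis
  show ?thesis
  proof (rule regular_funsI[OF polyfun.mult[OF g(1) g'(1)]])
    fix \<theta> :: "(real^'n^'n) \<times> (real^'n^'n)" assume "reg_det \<theta> \<noteq> 0"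
    from g(2)[OF this] g'(2)[OF this]
    show "reg_det \<theta> ^ (N + N') * (f \<theta> * f' \<theta>) = g \<theta> * g' \<theta>"
      by (metis (no_types, lifting) mult.assoc mult.left_commute power_add)
  qed
qed

lemma regular_add:
  fixes f f' :: "(real^'n::finite^'n) \<times> (real^'n^'n) \<Rightarrow> real"
  assumes "f \<in> regular_funs" "f' \<in> regular_funs"
  shows "(\<lambda>\<theta>. f \<theta> + f' \<theta>) \<in> regular_funs"
proof -
  obtain N g where
    g: "g \<in> polyfun par_coords" "\<And>\<theta>. reg_det \<theta> \<noteq> 0 \<Longrightarrow> reg_det \<theta> ^ N * f \<theta> = g \<theta>"
    using regular_funsE[OF assms(1)] by metis
  obtain N' g' where
    g': "g' \<in> polyfun par_coords" "\<And>\<theta>. reg_det \<theta> \<noteq> 0 \<Longrightarrow> reg_det \<theta> ^ N' * f' \<theta> = g' \<theta>"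
    using regular_funsE[OF assms(2)] by metis
  have "(\<lambda>\<theta>. reg_det \<theta> ^ N' * g \<theta> + reg_det \<theta> ^ N * g' \<theta>) \<in> polyfun par_coords"
    by (intro polyfun.add polyfun.mult polyfun_power polyfun_reg_det g(1) g'(1))
  then show ?thesis
  proof (rule regular_funsI)
    fix \<theta> :: "(real^'n^'n) \<times> (real^'n^'n)" assume "reg_det \<theta> \<noteq> 0"
    from g(2)[OF this, symmetric] g'(2)[OF this, symmetric]
    show "reg_det \<theta> ^ (N + N') * (f \<theta> + f' \<theta>) = reg_det \<theta> ^ N' * g \<theta> + reg_det \<theta> ^ N * g' \<theta>"
      by (simp add: power_add algebra_simps)
  qed
qed

lemma regular_const: "(\<lambda>_. c) \<in> regular_funs"
  by (intro regular_polyfun polyfun.const)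

lemma regular_sum:
  "(\<And>i. i \<in> I \<Longrightarrow> (\<lambda>x. f i x) \<in> regular_funs) \<Longrightarrow> (\<lambda>x. \<Sum>i\<in>I. f i x) \<in> regular_funs"
  by (induction I rule: infinite_finite_induct) (auto intro: regular_const regular_add)

lemma regular_polyfun_comp:
  assumes "q \<in> polyfun mat_coords" and "\<And>i j. (\<lambda>\<theta>. F \<theta> $ i $ j) \<in> regular_funs"
  shows "(\<lambda>\<theta>. q (F \<theta>)) \<in> regular_funs"
  using assms(1)
proof induction
  case (coord f)
  then show ?case using assms(2) by (auto simp: mat_coords_def)
qed (auto intro: regular_const regular_add regular_mult)

section \<open>Regularity of the entries of the inverse and of \<open>phi\<close>\<close>

lemma invertible_matrix_inv:
  fixes A :: "real^'n^'n"
  assumes "invertible A"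
  shows "A ** matrix_inv A = mat 1" "matrix_inv A ** A = mat 1"
  using someI_ex[OF assms[unfolded invertible_def]] by (simp_all add: matrix_inv_def)

text \<open>Column \<open>i\<close> of the inverse solves the system with right-hand side
  \<open>axis i 1\<close>; Cramer's rule then gives a polynomial numerator over
  \<open>det A\<close>.\<close>

lemma matrix_inv_cramer:
  fixes A :: "real^'n^'n"
  assumes "det A \<noteq> 0"
  shows "matrix_inv A $ a $ i = det (\<chi> r c. if c = a then axis i 1 $ r else A $ r $ c) / det A"
proof -
  have "A ** matrix_inv A = mat 1"
    using assms by (simp add: invertible_det_nz invertible_matrix_inv)
  then have "A *v column i (matrix_inv A) = axis i 1"
    by (simp add: Finite_Cartesian_Product.vec_eq_iff matrix_matrix_mult_def matrix_vector_mult_def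
        column_def Finite_Cartesian_Product.mat_def axis_def)
  then have "column i (matrix_inv A) = (\<chi> k. det (\<chi> r c. if c = k then axis i 1 $ r else A $ r $ c) / det A)"
    using cramer[OF assms] by blast
  then show ?thesis by (simp add: column_def Finite_Cartesian_Product.vec_eq_iff)
qed

lemma regular_matrix_inv:
  "(\<lambda>\<theta> :: (real^'n::finite^'n) \<times> (real^'n^'n). matrix_inv (mat 1 - fst \<theta>) $ a $ i) \<in> regular_funs"
proof -
  let ?g = "\<lambda>\<theta> :: (real^'n^'n) \<times> (real^'n^'n).
    det (\<chi> r c. if c = a then axis i 1 $ r else (mat 1 - fst \<theta>) $ r $ c)"
  have "?g \<in> polyfun par_coords"
  proof (rule polyfun_det)
    fix r c
    show "(\<lambda>\<theta> :: (real^'n^'n) \<times> (real^'n^'n).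
        (\<chi> r c. if c = a then axis i 1 $ r else (mat 1 - fst \<theta>) $ r $ c) $ r $ c) \<in> polyfun par_coords"
      using polyfun_I_minus_fst[of r c] by (cases "c = a") (auto intro: polyfun.const)
  qed
  then show ?thesis
    by (rule regular_funsI[where N = 1]) (auto simp: reg_det_def matrix_inv_cramer)
qed

lemma regular_phi:
  "(\<lambda>\<theta> :: (real^'n::finite^'n) \<times> (real^'n^'n). phi (fst \<theta>) (snd \<theta>) $ i $ j) \<in> regular_funs"
  unfolding phi_def matrix_matrix_mult_def transpose_def vec_lambda_beta
  by (intro regular_sum regular_mult regular_matrix_inv regular_polyfun polyfun_snd)

lemma polyfun_line:
  fixes \<theta>\<^sub>1 \<theta>\<^sub>2 :: "(real^'n::finite^'n) \<times> (real^'n^'n)"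
  assumes "p \<in> polyfun par_coords"
  shows "\<exists>r. \<forall>t. p ((1 - t) *\<^sub>R \<theta>\<^sub>1 + t *\<^sub>R \<theta>\<^sub>2) = poly r t"
  using assms
proof induction
  case (const c)
  show ?case by (rule exI[of _ "[:c:]"]) simp
next
  case (coord f)
  then have "\<exists>a b. \<forall>t. f ((1 - t) *\<^sub>R \<theta>\<^sub>1 + t *\<^sub>R \<theta>\<^sub>2) = (1 - t) * a + t * b"
    by (intro exI[of _ "f \<theta>\<^sub>1"] exI[of _ "f \<theta>\<^sub>2"]) (auto simp: par_coords_def)
  then obtain a b where "\<forall>t. f ((1 - t) *\<^sub>R \<theta>\<^sub>1 + t *\<^sub>R \<theta>\<^sub>2) = (1 - t) * a + t * b" by blast
  then show ?case
    by (intro exI[of _ "[:a, b - a:]"]) (auto simp: algebra_simps)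
next
  case (add f g)
  then obtain r s where "\<forall>t. f ((1 - t) *\<^sub>R \<theta>\<^sub>1 + t *\<^sub>R \<theta>\<^sub>2) = poly r t"
    "\<forall>t. g ((1 - t) *\<^sub>R \<theta>\<^sub>1 + t *\<^sub>R \<theta>\<^sub>2) = poly s t" by blast
  then show ?case by (intro exI[of _ "r + s"]) simp
next
  case (mult f g)
  then obtain r s where "\<forall>t. f ((1 - t) *\<^sub>R \<theta>\<^sub>1 + t *\<^sub>R \<theta>\<^sub>2) = poly r t"
    "\<forall>t. g ((1 - t) *\<^sub>R \<theta>\<^sub>1 + t *\<^sub>R \<theta>\<^sub>2) = poly s t" by blast
  then show ?case by (intro exI[of _ "r * s"]) simp
qed

text \<open>On the line, the two numerators and \<open>reg_det\<close> become univariate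
  polynomials, each nonzero at \<open>t = 0\<close> or \<open>t = 1\<close>. Their product has
  finitely many roots, so some \<open>t\<close> in the open unit interval avoids all of them. This
  does the work of irreducibility; staying strictly between the endpoints keeps convex conditions
  intact.\<close>

lemma regular_nonzero_on_line:
  fixes \<theta>\<^sub>1 \<theta>\<^sub>2 :: "(real^'n::finite^'n) \<times> (real^'n^'n)"
  assumes f: "f \<in> regular_funs" "f \<theta>\<^sub>1 \<noteq> 0" "reg_det \<theta>\<^sub>1 \<noteq> 0"
    and g: "g \<in> regular_funs" "g \<theta>\<^sub>2 \<noteq> 0" "reg_det \<theta>\<^sub>2 \<noteq> 0"
  obtains t where "0 < t" "t < 1"
    "f ((1 - t) *\<^sub>R \<theta>\<^sub>1 + t *\<^sub>R \<theta>\<^sub>2) \<noteq> 0" "g ((1 - t) *\<^sub>R \<theta>\<^sub>1 + t *\<^sub>R \<theta>\<^sub>2) \<noteq> 0"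
    "reg_det ((1 - t) *\<^sub>R \<theta>\<^sub>1 + t *\<^sub>R \<theta>\<^sub>2) \<noteq> 0"
proof -
  let ?\<theta> = "\<lambda>t. (1 - t) *\<^sub>R \<theta>\<^sub>1 + t *\<^sub>R \<theta>\<^sub>2"
  obtain N F where F: "F \<in> polyfun par_coords" "\<And>\<theta>. reg_det \<theta> \<noteq> 0 \<Longrightarrow> reg_det \<theta> ^ N * f \<theta> = F \<theta>"
    using regular_funsE[OF f(1)] by metis
  obtain K H where H: "H \<in> polyfun par_coords" "\<And>\<theta>. reg_det \<theta> \<noteq> 0 \<Longrightarrow> reg_det \<theta> ^ K * g \<theta> = H \<theta>"
    using regular_funsE[OF g(1)] by metis
  obtain p where p: "\<And>t. F (?\<theta> t) = poly p t" using polyfun_line[OF F(1)] by blast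
  obtain q where q: "\<And>t. H (?\<theta> t) = poly q t" using polyfun_line[OF H(1)] by blast
  obtain d where d: "\<And>t. reg_det (?\<theta> t) = poly d t" using polyfun_line[OF polyfun_reg_det] by blast
  have "poly p 0 \<noteq> 0" using p[of 0] F(2)[of \<theta>\<^sub>1] f by auto
  moreover have "poly q 1 \<noteq> 0" using q[of 1] H(2)[of \<theta>\<^sub>2] g by auto
  moreover have "poly d 0 \<noteq> 0" using d[of 0] f by auto
  ultimately have "p * q * d \<noteq> 0" by auto
  then have "finite {t. poly (p * q * d) t = 0}" by (rule poly_roots_finite)
  moreover have "infinite {0<..<1::real}" by simp
  ultimately obtain t where t: "t \<in> {0<..<1}" "poly (p * q * d) t \<noteq> 0"
    by (metis (mono_tags, lifting) finite_subset mem_Collect_eq subsetI)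
  then have nz: "F (?\<theta> t) \<noteq> 0" "H (?\<theta> t) \<noteq> 0" "reg_det (?\<theta> t) \<noteq> 0"
    by (simp_all add: p q d)
  show thesis
    by (rule that[of t]) (use t nz F(2)[of "?\<theta> t"] H(2)[of "?\<theta> t"] in auto)
qed

section \<open>Proper algebraic subsets of the parameter space\<close>

lemma Theta_iff:
  "(L, Om) \<in> Theta D B \<longleftrightarrow> (\<forall>x y. (x, y) \<notin> D \<longrightarrow> L $ x $ y = 0) \<and> reg_det (L, Om) \<noteq> 0 \<and> Om \<in> PDB B"
  by (auto simp: Theta_def RDreg_def reg_det_def invertible_det_nz)

lemma PDB_convex:
  assumes "Om \<in> PDB B" "Om' \<in> PDB B" "0 < t" "t < 1"
  shows "(1 - t) *\<^sub>R Om + t *\<^sub>R Om' \<in> PDB B"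
proof -
  have "x \<bullet> (((1 - t) *\<^sub>R Om + t *\<^sub>R Om') *v x) > 0" if "x \<noteq> 0" for x
  proof -
    have "x \<bullet> (((1 - t) *\<^sub>R Om + t *\<^sub>R Om') *v x) = (1 - t) * (x \<bullet> (Om *v x)) + t * (x \<bullet> (Om' *v x))"
      by (simp add: matrix_vector_mult_add_rdistrib inner_add_right scaleR_matrix_vector_assoc[symmetric])
    also have "\<dots> > 0"
      using assms that by (intro add_pos_pos mult_pos_pos) (auto simp: PDB_def pos_def_def)
    finally show ?thesis .
  qed
  moreover have "transpose ((1 - t) *\<^sub>R Om + t *\<^sub>R Om') = (1 - t) *\<^sub>R Om + t *\<^sub>R Om'"
  proof -
    have "Om $ i $ j = Om $ j $ i" "Om' $ i $ j = Om' $ j $ i" for i j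
      using assms(1,2) by (metis (mono_tags, lifting) PDB_def mem_Collect_eq pos_def_def transpose_def vec_lambda_beta)+
    then show ?thesis by (simp add: transpose_def Finite_Cartesian_Product.vec_eq_iff)
  qed
  ultimately show ?thesis
    using assms(1,2) by (auto simp: PDB_def pos_def_def)
qed

text \<open>Since \<open>reg_det\<close> has no zero on \<open>Theta D B\<close>, the zeros of
  \<open>f\<close> there are those of its polynomial numerator \<open>g\<close>.\<close>

lemma proper_alg_subset_regular:
  assumes f: "f \<in> regular_funs" and \<theta>: "\<theta> \<in> Theta D B" "f \<theta> \<noteq> 0"
  shows "proper_alg_subset D B {\<theta> \<in> Theta D B. f \<theta> = 0}"
proof -
  obtain N g where g: "g \<in> polyfun par_coords" "\<And>\<theta>. reg_det \<theta> \<noteq> 0 \<Longrightarrow> reg_det \<theta> ^ N * f \<theta> = g \<theta>"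
    using regular_funsE[OF f] by metis
  have "f \<theta> = 0 \<longleftrightarrow> g \<theta> = 0" if "\<theta> \<in> Theta D B" for \<theta>
  proof -
    have "reg_det \<theta> \<noteq> 0" using that Theta_iff[of "fst \<theta>" "snd \<theta>"] by simp
    then show ?thesis using g(2)[of \<theta>] by (metis mult_eq_0_iff power_not_zero)
  qed
  then have "{\<theta> \<in> Theta D B. f \<theta> = 0} = {\<theta> \<in> Theta D B. \<forall>p\<in>{g}. p \<theta> = 0}" by auto
  then show ?thesis
    unfolding proper_alg_subset_def using g(1) \<theta> by (intro conjI exI[of _ "{g}"]) auto
qed

text \<open>Each set lies in the zero set of one polynomial that is nonzero somewhere on
  \<open>Theta D B\<close>. A common nonzero is found on the segment between the two witnesses: the
  support conditions are linear, positive definiteness is convex, and \<open>t\<close> is chosen so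
  that \<open>reg_det\<close> does not vanish. The product of the polynomials then defines the
  superset.\<close>

lemma proper_alg_subset_Un:
  assumes "proper_alg_subset D B A\<^sub>1" "proper_alg_subset D B A\<^sub>2"
  shows "\<exists>A. proper_alg_subset D B A \<and> A\<^sub>1 \<union> A\<^sub>2 \<subseteq> A"
proof -
  have *: "\<exists>p \<theta>. p \<in> polyfun par_coords \<and> \<theta> \<in> Theta D B \<and> p \<theta> \<noteq> 0 \<and> A \<subseteq> {\<theta> \<in> Theta D B. p \<theta> = 0}"
    if A: "proper_alg_subset D B A" for A
  proof -
    obtain P where P: "P \<subseteq> polyfun par_coords" "A = {\<theta> \<in> Theta D B. \<forall>p\<in>P. p \<theta> = 0}" "A \<noteq> Theta D B"
      using A unfolding proper_alg_subset_def by blast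
    then obtain \<theta> p where "\<theta> \<in> Theta D B" "p \<in> P" "p \<theta> \<noteq> 0" by blast
    then show ?thesis using P by blast
  qed
  obtain p \<theta>\<^sub>1 where p: "p \<in> polyfun par_coords" "\<theta>\<^sub>1 \<in> Theta D B" "p \<theta>\<^sub>1 \<noteq> 0"
    "A\<^sub>1 \<subseteq> {\<theta> \<in> Theta D B. p \<theta> = 0}" using *[OF assms(1)] by blast
  obtain q \<theta>\<^sub>2 where q: "q \<in> polyfun par_coords" "\<theta>\<^sub>2 \<in> Theta D B" "q \<theta>\<^sub>2 \<noteq> 0"
    "A\<^sub>2 \<subseteq> {\<theta> \<in> Theta D B. q \<theta> = 0}" using *[OF assms(2)] by blast
  obtain L1 O1 L2 O2 where \<theta>: "\<theta>\<^sub>1 = (L1, O1)" "\<theta>\<^sub>2 = (L2, O2)" by fastforce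
  have "reg_det \<theta>\<^sub>1 \<noteq> 0" "reg_det \<theta>\<^sub>2 \<noteq> 0" using p(2) q(2) by (simp_all add: \<theta> Theta_iff)
  then obtain t where t: "0 < t" "t < 1"
    "p ((1 - t) *\<^sub>R \<theta>\<^sub>1 + t *\<^sub>R \<theta>\<^sub>2) \<noteq> 0" "q ((1 - t) *\<^sub>R \<theta>\<^sub>1 + t *\<^sub>R \<theta>\<^sub>2) \<noteq> 0"
    "reg_det ((1 - t) *\<^sub>R \<theta>\<^sub>1 + t *\<^sub>R \<theta>\<^sub>2) \<noteq> 0"
    using regular_nonzero_on_line[of p \<theta>\<^sub>1 q \<theta>\<^sub>2] p q regular_polyfun by blast
  have "(1 - t) *\<^sub>R \<theta>\<^sub>1 + t *\<^sub>R \<theta>\<^sub>2 \<in> Theta D B"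
    using p(2) q(2) t PDB_convex[of O1 B O2 t] by (auto simp: \<theta> Theta_iff)
  then have "proper_alg_subset D B {\<theta> \<in> Theta D B. p \<theta> * q \<theta> = 0}"
    using t p(1) q(1) by (intro proper_alg_subset_regular regular_polyfun polyfun.mult) auto
  then show ?thesis using p(4) q(4) by (intro exI[of _ "{\<theta> \<in> Theta D B. p \<theta> * q \<theta> = 0}"]) auto
qed

lemma proper_alg_subset_UN:
  assumes "finite I" "proper_alg_subset D B A\<^sub>0" "\<And>i. i \<in> I \<Longrightarrow> proper_alg_subset D B (A i)"
  shows "\<exists>A'. proper_alg_subset D B A' \<and> A\<^sub>0 \<union> (\<Union>i\<in>I. A i) \<subseteq> A'"
  using assms
proof (induction I)
  case empty
  then show ?case by auto
next
  case (insert i I)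
  then obtain A' where A': "proper_alg_subset D B A'" "A\<^sub>0 \<union> (\<Union>i\<in>I. A i) \<subseteq> A'" by blast
  show ?case
  proof -
    obtain A'' where "proper_alg_subset D B A''" "A' \<union> A i \<subseteq> A''"
      using proper_alg_subset_Un[OF A'(1) insert.prems(2)[of i]] by blast
    moreover from this have "A\<^sub>0 \<union> (\<Union>j\<in>insert i I. A j) \<subseteq> A''" using A'(2) by blast
    ultimately show ?thesis by blast
  qed
qed

section \<open>Unit flows and transversals\<close>

text \<open>Induction on \<open>card X\<close>. Either a proper nonempty subset is tight, and it is
  matched separately from the rest, or every such subset has a surplus neighbour, and one pair can
  be matched greedily.\<close>

lemma hall_marriage:
  fixes N :: "'a \<Rightarrow> 'b set"
  assumes "finite X" "\<And>x. x \<in> X \<Longrightarrow> finite (N x)"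
    and "\<And>Y. Y \<subseteq> X \<Longrightarrow> card Y \<le> card (\<Union>x\<in>Y. N x)"
  shows "\<exists>f. inj_on f X \<and> (\<forall>x\<in>X. f x \<in> N x)"
  using assms
proof (induction "card X" arbitrary: X N rule: less_induct)
  case less
  note fin = \<open>finite X\<close> and finN = less.prems(2) and hall = less.prems(3)
  have finU: "finite (\<Union>x\<in>Y. N x)" if "Y \<subseteq> X" for Y
    using that fin finN finite_subset[OF that] by blast
  consider "X = {}" | (tight) Y where "Y \<subset> X" "Y \<noteq> {}" "card (\<Union>x\<in>Y. N x) = card Y"
    | (loose) "X \<noteq> {}" "\<And>Y. Y \<subset> X \<Longrightarrow> Y \<noteq> {} \<Longrightarrow> card Y < card (\<Union>x\<in>Y. N x)"
    using hall by (metis le_neq_implies_less psubset_imp_subset)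
  then show ?case
  proof cases
    case tight
    let ?U = "\<Union>x\<in>Y. N x"
    have finY: "finite Y" using tight(1) fin finite_subset by blast
    have "card Y < card X" using tight(1) fin by (rule psubset_card_mono[rotated])
    then obtain f where f: "inj_on f Y" "\<forall>x\<in>Y. f x \<in> N x"
      using less.hyps[of Y N] tight(1) finY finN hall by (metis psubset_imp_subset subsetD subset_trans)
    have "card (X - Y) < card X"
      using tight(1,2) fin by (intro psubset_card_mono) auto
    \<comment> \<open>Hall's condition survives deleting the neighbours of \<open>Y\<close>: apply
      it to \<open>Z \<union> Y\<close> and subtract the tight part.\<close>
    moreover have "card Z \<le> card (\<Union>x\<in>Z. N x - ?U)" if Z: "Z \<subseteq> X - Y" for Z
    proof -
      have "card Z + card Y = card (Z \<union> Y)"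
        using Z fin finY by (intro card_Un_disjoint[symmetric]) (auto dest: finite_subset)
      also have "\<dots> \<le> card (\<Union>x\<in>Z \<union> Y. N x)"
        using Z tight(1) by (intro hall) blast
      also have "(\<Union>x\<in>Z \<union> Y. N x) = (\<Union>x\<in>Z. N x - ?U) \<union> ?U" by blast
      also have "card \<dots> \<le> card (\<Union>x\<in>Z. N x - ?U) + card ?U" by (rule card_Un_le)
      finally show ?thesis using tight(3) by simp
    qed
    ultimately obtain g where g: "inj_on g (X - Y)" "\<forall>x\<in>X - Y. g x \<in> N x - ?U"
      using less.hyps[of "X - Y" "\<lambda>x. N x - ?U"] fin finN by (metis DiffD1 finite_Diff)
    have "inj_on (\<lambda>x. if x \<in> Y then f x else g x) X"
      using f g unfolding inj_on_def by (smt (verit) DiffD2 DiffI UN_I)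
    then show ?thesis
      using f(2) g(2) by (intro exI[of _ "\<lambda>x. if x \<in> Y then f x else g x"]) auto
  next
    case loose
    then obtain x where x: "x \<in> X" by blast
    have "card {x} \<le> card (N x)" using hall[of "{x}"] x by simp
    then obtain y where y: "y \<in> N x" by fastforce
    have "card (X - {x}) < card X" using x fin by (intro psubset_card_mono) auto
    moreover have "card Z \<le> card (\<Union>z\<in>Z. N z - {y})" if Z: "Z \<subseteq> X - {x}" for Z
    proof (cases "Z = {}")
      case False
      have "Z \<subset> X" using Z x by blast
      then have "card Z < card (\<Union>z\<in>Z. N z)" using loose(2) False by blast
      also have "\<dots> \<le> card (insert y (\<Union>z\<in>Z. N z - {y}))"
        using finU[of Z] Z by (intro card_mono) auto
      also have "\<dots> \<le> Suc (card (\<Union>z\<in>Z. N z - {y}))" by (rule card_insert_le_m1) auto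
      finally show ?thesis by simp
    qed simp
    ultimately obtain f where f: "inj_on f (X - {x})" "\<forall>z\<in>X - {x}. f z \<in> N z - {y}"
      using less.hyps[of "X - {x}" "\<lambda>z. N z - {y}"] fin finN by (metis DiffD1 finite_Diff)
    have "inj_on (f(x := y)) X"
      using f unfolding inj_on_def by auto
    then show ?thesis
      using f(2) y by (intro exI[of _ "f(x := y)"]) auto
  qed simp
qed

lemma unit_flow_values_bdd:
  fixes E :: "'v::finite \<Rightarrow> 'v \<Rightarrow> bool"
  shows "bdd_above {(\<Sum>x\<in>UNIV. a x) | f a b. is_unit_flow E S T f a b}"
proof (rule bdd_aboveI)
  fix r assume "r \<in> {(\<Sum>x\<in>UNIV. a x) | f a b. is_unit_flow E S T f a b}"
  then obtain f a b where "r = (\<Sum>x\<in>UNIV. a x)" "is_unit_flow E S T f a b" by blast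
  moreover from this(2) have "\<And>x. a x \<le> 1" unfolding is_unit_flow_def by blast
  ultimately show "r \<le> real CARD('v)" using sum_mono[of UNIV a "\<lambda>_. 1"] by simp
qed

text \<open>Each arrow of \<open>p\<close> leaving a point outside \<open>T\<close> follows an edge
  or is a fixed point. Cutting the arrows from \<open>T\<close> back to \<open>S\<close> turns
  cycles of \<open>p\<close> into vertex-disjoint paths from \<open>S\<close> to \<open>T\<close>;
  one unit is sent along every remaining nontrivial arrow.\<close>

lemma max_flow_ge_card:
  fixes E :: "'v::finite \<Rightarrow> 'v \<Rightarrow> bool"
  assumes p: "p permutes UNIV" and pT: "p ` T = S" and ST: "S \<inter> T = {}"
    and E: "\<And>x. x \<notin> T \<Longrightarrow> p x = x \<or> E x (p x)"
  shows "real (card S) \<le> max_flow E S T"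
proof -
  define f :: "'v \<Rightarrow> 'v \<Rightarrow> real" where "f x y = (if x \<notin> T \<and> p x \<noteq> x \<and> p x = y then 1 else 0)" for x y
  let ?a = "indicator S :: 'v \<Rightarrow> real" and ?b = "indicator T :: 'v \<Rightarrow> real"
  obtain q where q: "\<And>x. q (p x) = x" "\<And>x. p (q x) = x"
    using permutes_inverses[OF p] by blast
  have pS: "p x \<in> S \<longleftrightarrow> x \<in> T" for x using pT q(1) by (metis imageE imageI)
  have out_sum: "(\<Sum>y\<in>UNIV. f x y) = (if x \<notin> T \<and> p x \<noteq> x then 1 else 0)" for x
  proof -
    have "f x y = (if y = p x then (if x \<notin> T \<and> p x \<noteq> x then 1 else 0) else 0)" for y
      by (auto simp: f_def)
    then show ?thesis by (simp add: sum.delta)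
  qed
  have f_q: "f y x = (if y = q x then (if x \<notin> S \<and> p x \<noteq> x then 1 else 0) else 0)" for x y
  proof (cases "y = q x")
    case True
    then have "p y = x" "y \<in> T \<longleftrightarrow> x \<in> S" "p y = y \<longleftrightarrow> p x = x" using q pS by metis+
    then show ?thesis using True by (simp add: f_def)
  next
    case False
    then have "p y \<noteq> x" using q by metis
    then show ?thesis using False by (simp add: f_def)
  qed
  have in_sum: "(\<Sum>y\<in>UNIV. f y x) = (if x \<notin> S \<and> p x \<noteq> x then 1 else 0)" for x
    unfolding f_q by (simp add: sum.delta)
  have bal: "?a x + (\<Sum>y\<in>UNIV. f y x) = ?b x + (\<Sum>y\<in>UNIV. f x y)" for x
    using pS[of x] ST by (auto simp: in_sum out_sum indicator_def)
  have "is_unit_flow E S T f ?a ?b"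
    unfolding is_unit_flow_def
  proof (intro conjI allI)
    show "?a x + (\<Sum>y\<in>UNIV. f y x) \<le> 1" for x by (simp add: in_sum indicator_def)
    show "\<not> E x y \<longrightarrow> f x y = 0" for x y using E[of x] by (auto simp: f_def)
    show "?a x + (\<Sum>y\<in>UNIV. f y x) = ?b x + (\<Sum>y\<in>UNIV. f x y)" for x by (rule bal)
  qed (auto simp: indicator_def f_def)
  then have "(\<Sum>x\<in>UNIV. ?a x) \<le> max_flow E S T"
    unfolding max_flow_def by (intro cSup_upper unit_flow_values_bdd) blast
  then show ?thesis by (simp add: indicator_def)
qed

text \<open>Rounds a real flow to a combinatorial object. The matrix \<open>P\<close> has row sums 1
  outside \<open>T\<close> and column sums \<open>1 - a y\<close>, so the columns in
  \<open>S\<close> carry total mass \<open>card S\<close> minus the flow value, which is below 1.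
  Hall's condition with \<open>S\<close> excluded thus fails by less than 1, hence, by integrality
  of cardinalities, not at all.\<close>

lemma bij_betw_of_unit_flow:
  fixes E :: "'v::finite \<Rightarrow> 'v \<Rightarrow> bool"
  assumes flow: "is_unit_flow E S T f a b" and card: "card S = card T"
    and large: "(\<Sum>x\<in>UNIV. a x) > real (card S) - 1"
  obtains p where "bij_betw p (- T) (- S)" "\<And>x. x \<notin> T \<Longrightarrow> p x = x \<or> E x (p x)"
proof -
  define thr where "thr x = b x + (\<Sum>y\<in>UNIV. f x y)" for x
  define P where "P x y = f x y + (if x = y then 1 - thr x else 0)" for x y
  define N where "N x = {y. y \<notin> S \<and> P x y > 0}" for x
  have thr_in: "thr x = a x + (\<Sum>y\<in>UNIV. f y x)" for x
    using flow by (simp add: is_unit_flow_def thr_def)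
  have thr1: "thr x \<le> 1" for x unfolding thr_in using flow unfolding is_unit_flow_def by blast
  have f0: "f x y \<ge> 0" for x y using flow by (simp add: is_unit_flow_def)
  have a0: "a x \<ge> 0" for x using flow by (simp add: is_unit_flow_def)
  have aS: "a x = 0" if "x \<notin> S" for x using flow that by (simp add: is_unit_flow_def)
  have P0: "P x y \<ge> 0" for x y unfolding P_def using thr1[of x] by (intro add_nonneg_nonneg f0) auto
  have rows: "(\<Sum>y\<in>UNIV. P x y) = 1" if "x \<notin> T" for x
  proof -
    have "b x = 0" using flow that by (simp add: is_unit_flow_def)
    then show ?thesis by (simp add: P_def sum.distrib thr_def)
  qed
  have cols: "(\<Sum>x\<in>UNIV. P x y) = 1 - a y" for y
    by (simp add: P_def sum.distrib thr_in)
  have hall: "card Y \<le> card (\<Union>x\<in>Y. N x)" if Y: "Y \<subseteq> - T" for Y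
  proof -
    let ?NY = "\<Union>x\<in>Y. N x"
    have disj: "?NY \<inter> S = {}" by (auto simp: N_def)
    have "real (card Y) = (\<Sum>x\<in>Y. \<Sum>y\<in>UNIV. P x y)"
      using Y by (simp add: rows subset_iff)
    also have "\<dots> = (\<Sum>x\<in>Y. \<Sum>y\<in>?NY \<union> S. P x y)"
    proof (rule sum.cong[OF refl], rule sum.mono_neutral_right)
      fix x assume "x \<in> Y"
      then show "\<forall>y\<in>UNIV - (?NY \<union> S). P x y = 0"
        using P0[of x] by (auto simp: N_def order.order_iff_strict)
    qed auto
    also have "\<dots> = (\<Sum>y\<in>?NY \<union> S. \<Sum>x\<in>Y. P x y)" by (rule sum.swap)
    also have "\<dots> \<le> (\<Sum>y\<in>?NY \<union> S. \<Sum>x\<in>UNIV. P x y)"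
      by (intro sum_mono sum_mono2) (auto simp: P0)
    also have "\<dots> = (\<Sum>y\<in>?NY. 1 - a y) + (\<Sum>y\<in>S. 1 - a y)"
      unfolding cols by (rule sum.union_disjoint) (use disj in auto)
    also have "\<dots> \<le> (\<Sum>y\<in>?NY. 1) + (\<Sum>y\<in>S. 1 - a y)"
      by (intro add_right_mono sum_mono) (simp add: a0)
    also have "\<dots> = card ?NY + card S - (\<Sum>y\<in>S. a y)"
      by (simp add: sum_subtractf)
    also have "(\<Sum>y\<in>S. a y) = (\<Sum>y\<in>UNIV. a y)"
      by (rule sum.mono_neutral_left) (auto simp: aS)
    finally show ?thesis using large by linarith
  qed
  obtain p where p: "inj_on p (- T)" "\<forall>x\<in>- T. p x \<in> N x"
    using hall_marriage[of "- T" N] hall by auto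
  have "p ` (- T) = - S"
  proof (rule card_subset_eq)
    show "p ` (- T) \<subseteq> - S" using p(2) by (auto simp: N_def)
    show "card (p ` (- T)) = card (- S)"
      unfolding card_image[OF p(1)] using card by (simp add: Compl_eq_Diff_UNIV card_Diff_subset)
  qed simp
  then have bij: "bij_betw p (- T) (- S)" using p(1) by (simp add: bij_betw_def)
  have "p x = x \<or> E x (p x)" if "x \<notin> T" for x
  proof (rule ccontr)
    assume *: "\<not> (p x = x \<or> E x (p x))"
    then have "f x (p x) = 0" using flow by (simp add: is_unit_flow_def)
    then have "P x (p x) = 0" using * by (auto simp: P_def)
    then show False using bspec[OF p(2), of x] that by (simp add: N_def)
  qed
  then show thesis using bij that by blast
qed

text \<open>Approximating the supremum is enough, because \<open>bij_betw_of_unit_flow\<close>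
  accepts every flow of value above \<open>card S - 1\<close>.\<close>

lemma max_flow_approx:
  fixes E :: "'v::finite \<Rightarrow> 'v \<Rightarrow> bool"
  assumes "c < max_flow E S T"
  obtains f a b where "is_unit_flow E S T f a b" "c < (\<Sum>x\<in>UNIV. a x)"
proof -
  let ?V = "{(\<Sum>x\<in>UNIV. a x) | f a b. is_unit_flow E S T f a b}"
  have "is_unit_flow E S T (\<lambda>_ _. 0) (\<lambda>_. 0) (\<lambda>_. 0)" by (simp add: is_unit_flow_def)
  then have "?V \<noteq> {}" by blast
  then obtain r where "r \<in> ?V" "c < r"
    using assms less_cSup_iff[OF _ unit_flow_values_bdd, of E S T c] unfolding max_flow_def by blast
  then show thesis using that by blast
qed

section \<open>Minors and flows\<close>

lemma det_nonzeroI: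
  fixes A :: "real^'n^'n"
  assumes "\<And>x. A *v x = 0 \<Longrightarrow> x = 0"
  shows "det A \<noteq> 0"
proof -
  have "\<exists>A'. A' ** A = mat 1"
    using assms by (subst matrix_left_invertible_ker) blast
  then show ?thesis
    by (simp add: invertible_left_inverse invertible_det_nz[symmetric])
qed

lemma det_nonzero_transversal:
  fixes A :: "real^'n^'n"
  assumes "det A \<noteq> 0"
  obtains p where "p permutes UNIV" "\<And>i. A $ i $ p i \<noteq> 0"
proof -
  obtain p where "p permutes (UNIV :: 'n set)" "of_int (sign p) * (\<Prod>i\<in>UNIV. A $ i $ p i) \<noteq> 0"
    using assms sum.neutral[of "{p. p permutes (UNIV :: 'n set)}"
      "\<lambda>p. of_int (sign p) * (\<Prod>i\<in>UNIV. A $ i $ p i)"]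
    unfolding Determinants.det_def by blast
  then show thesis using that[of p] by simp
qed

lemma sum_UNIV_Plus:
  fixes f :: "'a::finite + 'b::finite \<Rightarrow> real"
  shows "(\<Sum>z\<in>UNIV. f z) = (\<Sum>i\<in>UNIV. f (Inl i)) + (\<Sum>i\<in>UNIV. f (Inr i))"
  using sum.Plus[of "UNIV :: 'a set" "UNIV :: 'b set" f] by simp

text \<open>A kernel vector of the bordered matrix \<open>N\<close> amounts to a kernel vector of
  the chosen block of \<open>phi L Om\<close>. So \<open>N\<close> is nonsingular, and a permutation
  from a nonzero Leibniz term of \<open>det N\<close> supplies the paths for
  \<open>max_flow_ge_card\<close>.\<close>

lemma max_flow_ge_if_minor_nonzero:
  fixes L Om :: "real^'n::finite^'n"
  assumes \<theta>: "(L, Om) \<in> Theta D B" and ss: "distinct ss" and ts: "distinct ts"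
    and len: "length ss = length ts" and minor: "minor (phi L Om) ss ts \<noteq> 0"
  shows "real (length ss) \<le> max_flow (flow_graph D B) (Inl ` set ss) (Inr ` set ts)"
proof -
  let ?A = "mat 1 - L" and ?M = "matrix_inv (mat 1 - L)"
  have inv: "invertible ?A" and LD: "\<And>x y. (x, y) \<notin> D \<Longrightarrow> L $ x $ y = 0"
    and OB: "\<And>x y. x \<noteq> y \<Longrightarrow> (x, y) \<notin> B \<Longrightarrow> Om $ x $ y = 0"
    using \<theta> by (auto simp: Theta_def RDreg_def PDB_def)
  obtain \<beta> where \<beta>: "bij_betw \<beta> (set ts) (set ss)"
    using finite_same_card_bij[of "set ts" "set ss"] ss ts len by (auto simp: distinct_card)
  \<comment> \<open>The block matrix with rows \<open>(I - L)\<^sup>T, -Om\<close> and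
    \<open>0, I - L\<close>, except that the row of each sink \<open>Inr t\<close> is replaced by
    the unit vector at the source \<open>Inl (\<beta> t)\<close>.\<close>
  define N :: "real^('n + 'n)^('n + 'n)" where "N = (\<chi> x y. case x of
      Inl i \<Rightarrow> (case y of Inl j \<Rightarrow> ?A $ j $ i | Inr j \<Rightarrow> - Om $ i $ j)
    | Inr i \<Rightarrow> (if i \<in> set ts then (if y = Inl (\<beta> i) then 1 else 0)
         else (case y of Inl j \<Rightarrow> 0 | Inr j \<Rightarrow> ?A $ i $ j)))"
  have "det N \<noteq> 0"
  proof (rule det_nonzeroI)
    fix z :: "real^('n + 'n)" assume z: "N *v z = 0"
    define a b where "a = (\<chi> i. z $ Inl i)" and "b = (\<chi> i. z $ Inr i)"
    \<comment> \<open>The unprimed rows will give \<open>a = phi L Om *v y\<close>; the remaining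
      primed rows confine \<open>y\<close> to \<open>set ts\<close>, and the replaced ones make
      \<open>a\<close> vanish on \<open>set ss\<close>.\<close>
    define y where "y = ?A *v b"
    have Nz: "(\<Sum>j\<in>UNIV. N $ x $ Inl j * a $ j) + (\<Sum>j\<in>UNIV. N $ x $ Inr j * b $ j) = 0" for x
      using arg_cong[OF z, of "\<lambda>u. u $ x"]
      by (simp add: matrix_vector_mult_def sum_UNIV_Plus a_def b_def)
    have "transpose ?A *v a = Om *v b"
    proof (rule iffD2[OF Finite_Cartesian_Product.vec_eq_iff], rule allI)
      fix i show "(transpose ?A *v a) $ i = (Om *v b) $ i"
        using Nz[of "Inl i"] by (simp add: N_def matrix_vector_mult_def transpose_def sum_negf)
    qed
    moreover have b: "b = ?M *v y"
      by (simp add: y_def matrix_vector_mul_assoc invertible_matrix_inv[OF inv])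
    moreover have "transpose ?M ** transpose ?A = mat 1"
      by (simp only: matrix_transpose_mul[symmetric] invertible_matrix_inv[OF inv] transpose_mat)
    then have "transpose ?M *v (transpose ?A *v a) = a"
      by (metis matrix_vector_mul_assoc matrix_vector_mul_lid)
    ultimately have a: "a = phi L Om *v y"
      by (simp add: phi_def matrix_vector_mul_assoc[symmetric])
    have yT: "y $ i = 0" if "i \<notin> set ts" for i
      using Nz[of "Inr i"] that by (simp add: N_def y_def matrix_vector_mult_def)
    have "a $ \<beta> t = 0" if "t \<in> set ts" for t
      using Nz[of "Inr t"] that by (simp add: N_def if_distrib[of "\<lambda>x. x * _"] sum.delta' cong: if_cong)
    then have "a $ s = 0" if "s \<in> set ss" for s
      using that bij_betw_imp_surj_on[OF \<beta>] by (metis imageE)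
    moreover have "a $ s = (\<Sum>t\<in>set ts. phi L Om $ s $ t * y $ t)" for s
      unfolding a matrix_vector_mult_def vec_lambda_beta
      by (rule sum.mono_neutral_right) (auto simp: yT)
    ultimately have "\<forall>t\<in>set ts. y $ t = 0"
      using minor_nonzero_iff[OF ts len, of "phi L Om"] minor by auto
    then have "y = 0" using yT by (auto simp: Finite_Cartesian_Product.vec_eq_iff)
    then have "a = 0" "b = 0" using a b by simp_all
    then show "z = 0"
      by (auto simp: Finite_Cartesian_Product.vec_eq_iff a_def b_def split_sum_all)
  qed
  then obtain p where p: "p permutes UNIV" "\<And>x. N $ x $ p x \<noteq> 0"
    using det_nonzero_transversal by blast
  \<comment> \<open>The unit rows force the permutation to jump from every sink to its partner
    source; all other nonzero entries are diagonal or sit on flow edges.\<close>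
  have pT: "p (Inr t) = Inl (\<beta> t)" if "t \<in> set ts" for t
    using p(2)[of "Inr t"] that by (simp add: N_def split: if_splits)
  have edge: "p x = x \<or> flow_graph D B x (p x)" if "x \<notin> Inr ` set ts" for x
  proof (cases x)
    case (Inl i)
    show ?thesis
    proof (cases "p x")
      case (Inl j)
      have "?A $ j $ i \<noteq> 0" using p(2)[of x] Inl \<open>x = Inl i\<close> by (simp add: N_def)
      then have "j = i \<or> (j, i) \<in> D" using LD[of j i] by (auto simp: Finite_Cartesian_Product.mat_def split: if_splits)
      then show ?thesis using Inl \<open>x = Inl i\<close> by (auto simp: flow_graph_def)
    next
      case (Inr j)
      have "Om $ i $ j \<noteq> 0" using p(2)[of x] Inr \<open>x = Inl i\<close> by (simp add: N_def)
      then have "j = i \<or> (i, j) \<in> B" using OB[of i j] by auto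
      then show ?thesis using Inr \<open>x = Inl i\<close> by (auto simp: flow_graph_def)
    qed
  next
    case (Inr i)
    then have i: "i \<notin> set ts" using that by auto
    then obtain j where j: "p x = Inr j" "?A $ i $ j \<noteq> 0"
      using p(2)[of x] Inr by (auto simp: N_def split: sum.splits)
    then have "j = i \<or> (i, j) \<in> D" using LD[of i j] by (auto simp: Finite_Cartesian_Product.mat_def split: if_splits)
    then show ?thesis using Inr j by (auto simp: flow_graph_def)
  qed
  have "p ` (Inr ` set ts) = Inl ` set ss"
    using bij_betw_imp_surj_on[OF \<beta>] pT by (force simp: image_image)
  then have "real (card (Inl ` set ss :: ('n + 'n) set)) \<le> max_flow (flow_graph D B) (Inl ` set ss) (Inr ` set ts)"
    by (intro max_flow_ge_card[OF p(1)] edge) auto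
  then show ?thesis using ss by (simp add: card_image distinct_card)
qed

text \<open>The map \<open>\<tau>\<close> encodes vertex-disjoint directed paths from
  \<open>X\<close> to \<open>Y\<close>, possibly with cycles. The conclusion says that the block of
  the inverse with rows \<open>X\<close> and columns \<open>Y\<close> is nonsingular, in a form free
  of orderings.\<close>

lemma path_system_matrix:
  fixes D :: "('n::finite \<times> 'n) set"
  assumes bij: "bij_betw \<tau> (- X) (- Y)" and edge: "\<forall>x\<in>- X. \<tau> x = x \<or> (\<tau> x, x) \<in> D"
  obtains L :: "real^'n^'n" where "\<forall>x y. (x, y) \<notin> D \<longrightarrow> L $ x $ y = 0" "det (mat 1 - L) \<noteq> 0"
    "\<forall>u. (\<forall>i\<in>- X. u $ i = 0) \<longrightarrow>
       (\<forall>j\<in>Y. (\<Sum>i\<in>UNIV. u $ i * matrix_inv (mat 1 - L) $ i $ j) = 0) \<longrightarrow> u = 0"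
proof -
  \<comment> \<open>Weight 1/2 on every edge in use: each column has at most one nonzero entry, so
    the largest absolute value of a kernel vector is at most half of itself, which gives
    invertibility even in the presence of cycles.\<close>
  define L :: "real^'n^'n" where "L = (\<chi> i j. if j \<notin> X \<and> \<tau> j \<noteq> j \<and> i = \<tau> j then 1/2 else 0)"
  let ?A = "mat 1 - L"
  let ?M = "matrix_inv ?A"
  have LD: "L $ x $ y = 0" if "(x, y) \<notin> D" for x y
    using that bspec[OF edge, of y] by (auto simp: L_def)
  have tA: "(transpose ?A *v w) $ j = w $ j - (if j \<notin> X \<and> \<tau> j \<noteq> j then w $ \<tau> j / 2 else 0)" for w j
  proof -
    have "(transpose ?A *v w) $ j = (\<Sum>i\<in>UNIV. mat 1 $ i $ j * w $ i) - (\<Sum>i\<in>UNIV. L $ i $ j * w $ i)"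
      by (simp add: matrix_vector_mult_def transpose_def left_diff_distrib sum_subtractf)
    moreover have "(\<Sum>i\<in>UNIV. mat 1 $ i $ j * w $ i) = w $ j"
      by (simp add: Finite_Cartesian_Product.mat_def if_distrib[of "\<lambda>x. x * _"] cong: if_cong)
    moreover have "(\<Sum>i\<in>UNIV. L $ i $ j * w $ i) = (if j \<notin> X \<and> \<tau> j \<noteq> j then w $ \<tau> j / 2 else 0)"
      by (simp add: L_def if_distrib[of "\<lambda>x. x * _"] cong: if_cong)
    ultimately show ?thesis by simp
  qed
  have "det (transpose ?A) \<noteq> 0"
  proof (rule det_nonzeroI)
    fix w :: "real^'n" assume w: "transpose ?A *v w = 0"
    define m where "m = Max (range (\<lambda>j. \<bar>w $ j\<bar>))"
    have le: "\<bar>w $ j\<bar> \<le> m" for j by (simp add: m_def)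
    have "m \<in> range (\<lambda>j. \<bar>w $ j\<bar>)" unfolding m_def by (rule Max_in) auto
    then obtain j where j: "m = \<bar>w $ j\<bar>" by blast
    have "w $ j = (if j \<notin> X \<and> \<tau> j \<noteq> j then w $ \<tau> j / 2 else 0)"
      using tA[of w j] w by simp
    then have "\<bar>w $ j\<bar> \<le> m / 2" using le[of "\<tau> j"] j by (auto split: if_splits)
    then have "m \<le> 0" using j by simp
    then have "w $ i = 0" for i using le[of i] by linarith
    then show "w = 0" by (simp add: Finite_Cartesian_Product.vec_eq_iff)
  qed
  then have detA: "det ?A \<noteq> 0" by simp
  then have inv: "invertible ?A" by (simp add: invertible_det_nz)
  have "u = 0" if uX: "\<And>i. i \<notin> X \<Longrightarrow> u $ i = 0"
    and uY: "\<And>j. j \<in> Y \<Longrightarrow> (\<Sum>i\<in>UNIV. u $ i * ?M $ i $ j) = 0" for u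
  proof -
    define w where "w = transpose ?M *v u"
    have wY: "w $ j = 0" if "j \<in> Y" for j
      using uY[OF that] by (simp add: w_def matrix_vector_mult_def transpose_def mult.commute)
    have "transpose ?A ** transpose ?M = mat 1"
      by (simp only: matrix_transpose_mul[symmetric] invertible_matrix_inv[OF inv] transpose_mat)
    then have u: "transpose ?A *v w = u"
      unfolding w_def by (metis matrix_vector_mul_assoc matrix_vector_mul_lid)
    have wX: "w $ j = (if \<tau> j \<noteq> j then w $ \<tau> j / 2 else 0)" if "j \<notin> X" for j
      using tA[of w j] u uX[OF that] that by simp
    have "w = 0"
    proof (rule ccontr)
      assume "w \<noteq> 0"
      let ?Z = "{z. w $ z \<noteq> 0}"
      have "?Z \<noteq> {}" using \<open>w \<noteq> 0\<close> by (auto simp: Finite_Cartesian_Product.vec_eq_iff)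
      \<comment> \<open>Take a nonzero entry of least absolute value. It lies outside
        \<open>Y\<close>, so \<open>z = \<tau> x\<close> with \<open>x\<close> outside
        \<open>X\<close>, and the entry at \<open>x\<close> is half as large yet nonzero.\<close>
      then obtain z where z: "w $ z \<noteq> 0" "\<And>x. w $ x \<noteq> 0 \<Longrightarrow> \<bar>w $ z\<bar> \<le> \<bar>w $ x\<bar>"
        using ex_min_if_finite[of "(\<lambda>x. \<bar>w $ x\<bar>) ` ?Z"] by (auto simp: not_less)
      have "z \<in> - Y" using z(1) wY by blast
      then obtain x where x: "x \<notin> X" "z = \<tau> x"
        using bij_betw_imp_surj_on[OF bij] by blast
      then have "w $ x = w $ z / 2" using wX[OF x(1)] z(1) by (auto split: if_splits)
      then show False using z(2)[of x] z(1) by simp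
    qed
    then show "u = 0" using u by simp
  qed
  then show thesis using LD detA by (intro that[of L]) auto
qed

text \<open>\<open>X\<close> consists of the vertices at which the transversal crosses to the primed
  copy and \<open>\<sigma>\<close> records the crossings; \<open>\<tau>\<close> and
  \<open>\<rho>\<close> describe the motion inside the two copies.\<close>

lemma flow_graph_bij_split:
  fixes D B :: "('n::finite \<times> 'n) set"
  assumes bij: "bij_betw p (- Inr ` T) (- Inl ` S)"
    and edge: "\<And>x. x \<notin> Inr ` T \<Longrightarrow> p x = x \<or> flow_graph D B x (p x)"
  obtains X \<sigma> \<tau> \<rho> where
    "inj_on \<sigma> X" "\<forall>i\<in>X. \<sigma> i = i \<or> (i, \<sigma> i) \<in> B"
    "bij_betw \<tau> (- X) (- S)" "\<forall>i\<in>- X. \<tau> i = i \<or> (\<tau> i, i) \<in> D"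
    "bij_betw \<rho> (- \<sigma> ` X) (- T)" "\<forall>i\<in>- \<sigma> ` X. \<rho> i = i \<or> (\<rho> i, i) \<in> D"
proof -
  define X where "X = {i. \<exists>j. p (Inl i) = Inr j}"
  define \<sigma> where "\<sigma> i = projr (p (Inl i))" for i
  define \<tau> where "\<tau> i = projl (p (Inl i))" for i
  define \<pi> where "\<pi> i = projr (p (Inr i))" for i
  have \<sigma>: "p (Inl i) = Inr (\<sigma> i)" if "i \<in> X" for i using that by (auto simp: X_def \<sigma>_def)
  have \<tau>: "p (Inl i) = Inl (\<tau> i)" if "i \<notin> X" for i
    using that by (cases "p (Inl i)") (auto simp: X_def \<tau>_def)
  \<comment> \<open>No edge of the flow graph leads from the primed copy back to the unprimed
    one.\<close>
  have \<pi>: "p (Inr i) = Inr (\<pi> i)" if "i \<notin> T" for i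
  proof -
    have "Inr i \<notin> Inr ` T" using that by auto
    from edge[OF this] show ?thesis by (auto simp: \<pi>_def flow_graph_def)
  qed
  have inj: "inj_on p (- Inr ` T)" and im: "p ` (- Inr ` T) = - Inl ` S"
    using bij by (simp_all add: bij_betw_def)
  have injD: "x = y" if "p x = p y" "x \<notin> Inr ` T" "y \<notin> Inr ` T" for x y
    using inj_onD[OF inj that(1)] that(2,3) by simp
  have surj: "\<exists>x. x \<notin> Inr ` T \<and> p x = y" if "y \<notin> Inl ` S" for y
    using im that by (metis ComplD ComplI imageE)
  have notS: "p x \<notin> Inl ` S" if "x \<notin> Inr ` T" for x
    using im that by blast
  have injL: "x = y" if "p (Inl x) = p (Inl y)" for x y
    using injD[OF that] by auto
  have injR: "x = y" if "p (Inr x) = p (Inr y)" "x \<notin> T" "y \<notin> T" for x y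
    using injD[OF that(1)] that(2,3) by auto
  have injLR: "p (Inl x) \<noteq> p (Inr y)" if "y \<notin> T" for x y
    using injD[of "Inl x" "Inr y"] that by auto
  have inj_\<sigma>: "inj_on \<sigma> X"
    by (intro inj_onI injL) (simp add: \<sigma>)
  have bij_\<tau>: "bij_betw \<tau> (- X) (- S)"
  proof (rule bij_betw_imageI)
    show "inj_on \<tau> (- X)"
      by (intro inj_onI injL) (simp add: \<tau>)
    show "\<tau> ` (- X) = - S"
    proof (intro equalityI subsetI)
      fix j assume "j \<in> \<tau> ` (- X)"
      then show "j \<in> - S" using \<tau> notS[of "Inl _"] by force
    next
      fix j assume "j \<in> - S"
      then obtain x where x: "x \<notin> Inr ` T" "p x = Inl j" using surj[of "Inl j"] by auto
      obtain i where i: "x = Inl i" using x \<pi> by (cases x) force+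
      then have "i \<notin> X" using x \<sigma>[of i] by auto
      then show "j \<in> \<tau> ` (- X)" using \<tau>[of i] x i by force
    qed
  qed
  have bij_\<pi>: "bij_betw \<pi> (- T) (- \<sigma> ` X)"
  proof (rule bij_betw_imageI)
    show "inj_on \<pi> (- T)"
      by (intro inj_onI injR) (simp_all add: \<pi>)
    show "\<pi> ` (- T) = - \<sigma> ` X"
    proof (intro equalityI subsetI)
      fix j assume "j \<in> \<pi> ` (- T)"
      then obtain i where i: "i \<notin> T" "j = \<pi> i" by blast
      have "j \<noteq> \<sigma> x" if "x \<in> X" for x
        using injLR[OF i(1), of x] i(2) \<pi>[OF i(1)] \<sigma>[OF that] by auto
      then show "j \<in> - \<sigma> ` X" by blast
    next
      fix j assume j: "j \<in> - \<sigma> ` X"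
      obtain x where x: "x \<notin> Inr ` T" "p x = Inr j" using surj[of "Inr j"] by auto
      obtain i where i: "x = Inr i"
      proof (cases x)
        case (Inl i)
        then have "i \<in> X" using x by (auto simp: X_def)
        then show ?thesis using \<sigma>[of i] j x Inl by auto
      qed
      then have "i \<notin> T" using x by auto
      then show "j \<in> \<pi> ` (- T)" using \<pi>[of i] x i by force
    qed
  qed
  \<comment> \<open>Primed edges follow \<open>D\<close> while unprimed edges reverse it. Inverting
    \<open>\<pi>\<close> gives \<open>\<rho>\<close> the orientation of \<open>\<tau>\<close>, so
    \<open>path_system_matrix\<close> serves both.\<close>
  define \<rho> where "\<rho> = the_inv_into (- T) \<pi>"
  have bij_\<rho>: "bij_betw \<rho> (- \<sigma> ` X) (- T)"
    unfolding \<rho>_def by (rule bij_betw_the_inv_into[OF bij_\<pi>])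
  have \<rho>: "\<rho> i \<notin> T" "\<pi> (\<rho> i) = i" if "i \<notin> \<sigma> ` X" for i
    using bij_betwE[OF bij_\<rho>] f_the_inv_into_f_bij_betw[OF bij_\<pi>, of i] that by (auto simp: \<rho>_def)
  show thesis
  proof (rule that[OF inj_\<sigma> _ bij_\<tau> _ bij_\<rho>]; intro ballI)
    show "\<sigma> i = i \<or> (i, \<sigma> i) \<in> B" if "i \<in> X" for i
      using edge[of "Inl i"] \<sigma>[OF that] by (auto simp: flow_graph_def)
    show "\<tau> i = i \<or> (\<tau> i, i) \<in> D" if "i \<in> - X" for i
      using edge[of "Inl i"] \<tau>[of i] that by (auto simp: flow_graph_def)
    show "\<rho> i = i \<or> (\<rho> i, i) \<in> D" if "i \<in> - \<sigma> ` X" for i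
    proof -
      have i: "i \<notin> \<sigma> ` X" using that by simp
      have "Inr (\<rho> i) \<notin> Inr ` T" using \<rho>(1)[OF i] by auto
      from edge[OF this] show ?thesis
        using \<pi>[OF \<rho>(1)[OF i]] \<rho>(2)[OF i] by (auto simp: flow_graph_def)
    qed
  qed
qed

section \<open>Parameters with a nonzero minor, built from Gram matrices\<close>

lemma regular_minor_mult_inv:
  "(\<lambda>\<theta> :: (real^'n::finite^'n) \<times> (real^'n^'n). minor (snd \<theta> ** matrix_inv (mat 1 - fst \<theta>)) rs cs)
     \<in> regular_funs"
proof (rule regular_polyfun_comp[OF polyfun_minor])
  fix i j
  show "(\<lambda>\<theta> :: (real^'n::finite^'n) \<times> (real^'n^'n).
      (snd \<theta> ** matrix_inv (mat 1 - fst \<theta>)) $ i $ j) \<in> regular_funs"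
    unfolding matrix_matrix_mult_def vec_lambda_beta
    by (intro regular_sum regular_mult regular_matrix_inv regular_polyfun polyfun_snd)
qed

lemma regular_minor_phi:
  "(\<lambda>\<theta> :: (real^'n::finite^'n) \<times> (real^'n^'n). minor (phi (fst \<theta>) (snd \<theta>)) rs cs) \<in> regular_funs"
  by (rule regular_polyfun_comp[OF polyfun_minor regular_phi])

text \<open>As \<open>K\<close> vanishes outside the rows \<open>xs\<close>, the block of
  \<open>transpose K ** K\<close> factors through two square blocks of \<open>K\<close>, both
  nonsingular. The kernel criterion is applied to each factor in turn.\<close>

lemma minor_gram_nonzero:
  fixes K :: "real^'n::finite^'n"
  assumes xs: "distinct xs" and cs: "distinct cs"
    and len: "length xs = length rs" "length xs = length cs"
    and rows: "\<And>i j. i \<notin> set xs \<Longrightarrow> K $ i $ j = 0"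
    and nz: "minor K xs rs \<noteq> 0" "minor K xs cs \<noteq> 0"
  shows "minor (transpose K ** K) rs cs \<noteq> 0"
proof -
  have "\<forall>c\<in>set cs. y c = 0"
    if y: "\<And>r. r \<in> set rs \<Longrightarrow> (\<Sum>c\<in>set cs. (transpose K ** K) $ r $ c * y c) = 0" for y
  proof -
    define z where "z i = (\<Sum>c\<in>set cs. K $ i $ c * y c)" for i
    have "(\<Sum>i\<in>set xs. z i * K $ i $ r) = 0" if "r \<in> set rs" for r
    proof -
      have "(\<Sum>i\<in>set xs. z i * K $ i $ r) = (\<Sum>i\<in>UNIV. z i * K $ i $ r)"
        by (rule sum.mono_neutral_left) (auto simp: rows)
      also have "\<dots> = (\<Sum>i\<in>UNIV. \<Sum>c\<in>set cs. K $ i $ r * K $ i $ c * y c)"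
        by (simp add: z_def sum_distrib_left mult_ac)
      also have "\<dots> = (\<Sum>c\<in>set cs. (transpose K ** K) $ r $ c * y c)"
        by (subst sum.swap) (simp add: matrix_matrix_mult_def transpose_def sum_distrib_right)
      finally show ?thesis using y[OF that] by simp
    qed
    then have "\<forall>i\<in>set xs. z i = 0"
      using nz(1) minor_nonzero_iff_left[OF xs len(1), of K] by blast
    then show ?thesis
      using nz(2) minor_nonzero_iff[OF cs len(2), of K] by (simp add: z_def)
  qed
  then show ?thesis
    using minor_nonzero_iff[OF cs, of rs "transpose K ** K"] len by auto
qed

lemma pos_def_gram_plus_scaled_id:
  fixes H :: "real^'n::finite^'n"
  assumes "t > 0"
  shows "pos_def (transpose H ** H + t *\<^sub>R mat 1)"
proof -
  have "x \<bullet> ((transpose H ** H + t *\<^sub>R mat 1) *v x) > 0" if "x \<noteq> 0" for x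
  proof -
    have "x \<bullet> ((transpose H ** H + t *\<^sub>R mat 1) *v x) = x \<bullet> (transpose H *v (H *v x)) + t * (x \<bullet> x)"
      by (simp add: matrix_vector_mult_add_rdistrib inner_add_right scaleR_matrix_vector_assoc[symmetric]
          matrix_vector_mul_assoc)
    also have "x \<bullet> (transpose H *v (H *v x)) = (H *v x) \<bullet> (H *v x)"
      by (simp add: dot_lmul_matrix[symmetric] inner_commute)
    finally show ?thesis using assms that by (simp add: add_nonneg_pos)
  qed
  moreover have "transpose (transpose H ** H + t *\<^sub>R mat 1) = transpose H ** H + t *\<^sub>R mat 1"
    by (simp add: Finite_Cartesian_Product.vec_eq_iff transpose_def matrix_matrix_mult_def
        Finite_Cartesian_Product.mat_def mult.commute)
  ultimately show ?thesis by (simp add: pos_def_def)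
qed

lemma minor_phi_not_identically_zero:
  fixes D B :: "('n::finite \<times> 'n) set"
  assumes B: "sym B" and ss: "distinct ss" and ts: "distinct ts" and len: "length ss = length ts"
    and flow: "max_flow (flow_graph D B) (Inl ` set ss) (Inr ` set ts) > real (length ss) - 1"
  obtains \<theta> where "\<theta> \<in> Theta D B" "minor (phi (fst \<theta>) (snd \<theta>)) ss ts \<noteq> 0"
proof -
  let ?M = "\<lambda>L :: real^'n^'n. matrix_inv (mat 1 - L)"
  obtain f a b where f: "is_unit_flow (flow_graph D B) (Inl ` set ss) (Inr ` set ts) f a b"
    "real (length ss) - 1 < (\<Sum>x\<in>UNIV. a x)"
    using max_flow_approx[OF flow] by blast
  have "card (Inl ` set ss :: ('n + 'n) set) = length ss" "card (Inr ` set ts :: ('n + 'n) set) = length ss"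
    using ss ts len by (simp_all add: card_image distinct_card)
  then obtain p where p: "bij_betw p (- Inr ` set ts) (- Inl ` set ss)"
    "\<And>x. x \<notin> Inr ` set ts \<Longrightarrow> p x = x \<or> flow_graph D B x (p x)"
    using bij_betw_of_unit_flow[OF f(1)] f(2) by metis
  obtain X \<sigma> \<tau> \<rho> where \<sigma>: "inj_on \<sigma> X" "\<forall>i\<in>X. \<sigma> i = i \<or> (i, \<sigma> i) \<in> B"
    and \<tau>: "bij_betw \<tau> (- X) (- set ss)" "\<forall>i\<in>- X. \<tau> i = i \<or> (\<tau> i, i) \<in> D"
    and \<rho>: "bij_betw \<rho> (- \<sigma> ` X) (- set ts)" "\<forall>i\<in>- \<sigma> ` X. \<rho> i = i \<or> (\<rho> i, i) \<in> D"
    by (rule flow_graph_bij_split[OF p]) (assumption, rule that)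
  obtain L1 where L1: "\<forall>x y. (x, y) \<notin> D \<longrightarrow> L1 $ x $ y = 0" "det (mat 1 - L1) \<noteq> 0"
    "\<forall>u. (\<forall>i\<in>- X. u $ i = 0) \<longrightarrow>
       (\<forall>j\<in>set ss. (\<Sum>i\<in>UNIV. u $ i * ?M L1 $ i $ j) = 0) \<longrightarrow> u = 0"
    by (rule path_system_matrix[OF \<tau>])
  obtain L2 where L2: "\<forall>x y. (x, y) \<notin> D \<longrightarrow> L2 $ x $ y = 0" "det (mat 1 - L2) \<noteq> 0"
    "\<forall>u. (\<forall>i\<in>- \<sigma> ` X. u $ i = 0) \<longrightarrow>
       (\<forall>j\<in>set ts. (\<Sum>i\<in>UNIV. u $ i * ?M L2 $ i $ j) = 0) \<longrightarrow> u = 0"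
    by (rule path_system_matrix[OF \<rho>])
  obtain xs where xs: "set xs = X" "distinct xs"
    using finite_distinct_list[of X] by auto
  have "card (- X) = card (- set ss)" using bij_betw_same_card[OF \<tau>(1)] .
  moreover have "card X \<le> CARD('n)" "card (set ss) \<le> CARD('n)" by (simp_all add: card_mono)
  ultimately have "card X = card (set ss)"
    by (simp add: Compl_eq_Diff_UNIV card_Diff_subset)
  then have len_xs: "length xs = length ss" "length xs = length ts"
    using xs ss len distinct_card by metis+
  \<comment> \<open>For \<open>i\<close> in \<open>X\<close>, row \<open>i\<close> of
    \<open>H1\<close> selects the path system ending at \<open>ss\<close> and row \<open>i\<close>
    of \<open>H2\<close>, shifted by \<open>\<sigma>\<close>, the one ending at \<open>ts\<close>.
    Any mixture has row \<open>i\<close> supported on \<open>i\<close> and \<open>\<sigma> i\<close>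
    only.\<close>
  define H1 :: "real^'n^'n" where "H1 = (\<chi> i j. if i \<in> X \<and> j = i then 1 else 0)"
  define H2 :: "real^'n^'n" where "H2 = (\<chi> i j. if i \<in> X \<and> j = \<sigma> i then 1 else 0)"
  have H1: "(H1 ** M) $ i $ j = (if i \<in> X then M $ i $ j else 0)" for M i j
    by (simp add: H1_def matrix_matrix_mult_def if_distrib[of "\<lambda>x. x * _"] cong: if_cong)
  have H2: "(H2 ** M) $ i $ j = (if i \<in> X then M $ \<sigma> i $ j else 0)" for M i j
    by (simp add: H2_def matrix_matrix_mult_def if_distrib[of "\<lambda>x. x * _"] cong: if_cong)
  have nz1: "minor (H1 ** ?M L1) xs ss \<noteq> 0"
  proof (subst minor_nonzero_iff_left[OF xs(2) len_xs(1)], intro allI impI)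
    fix y :: "'n \<Rightarrow> real"
    assume y: "\<forall>c\<in>set ss. (\<Sum>r\<in>set xs. y r * (H1 ** ?M L1) $ r $ c) = 0"
    \<comment> \<open>Extension by zero turns a left kernel vector on \<open>xs\<close> into a row
      vector over all vertices, as \<open>path_system_matrix\<close> expects.\<close>
    define u where "u = (\<chi> i. if i \<in> X then y i else 0)"
    have "(\<Sum>i\<in>UNIV. u $ i * ?M L1 $ i $ j) = (\<Sum>r\<in>set xs. y r * (H1 ** ?M L1) $ r $ j)" for j
      by (rule sum.mono_neutral_cong_right) (auto simp: u_def xs H1)
    then have "u = 0" using y by (intro L1(3)[rule_format]) (auto simp: u_def)
    moreover have "u $ r = y r" if "r \<in> X" for r using that by (simp add: u_def)
    ultimately show "\<forall>r\<in>set xs. y r = 0" by (auto simp: xs)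
  qed
  have nz2: "minor (H2 ** ?M L2) xs ts \<noteq> 0"
  proof (subst minor_nonzero_iff_left[OF xs(2) len_xs(2)], intro allI impI)
    fix y :: "'n \<Rightarrow> real"
    assume y: "\<forall>c\<in>set ts. (\<Sum>r\<in>set xs. y r * (H2 ** ?M L2) $ r $ c) = 0"
    define u where "u = (\<chi> i. if i \<in> \<sigma> ` X then y (the_inv_into X \<sigma> i) else 0)"
    have u: "u $ \<sigma> i = y i" if "i \<in> X" for i
      using that by (simp add: u_def the_inv_into_f_f[OF \<sigma>(1)])
    have "(\<Sum>i\<in>UNIV. u $ i * ?M L2 $ i $ j) = (\<Sum>r\<in>set xs. y r * (H2 ** ?M L2) $ r $ j)" for j
    proof -
      have "(\<Sum>i\<in>UNIV. u $ i * ?M L2 $ i $ j) = (\<Sum>i\<in>\<sigma> ` X. u $ i * ?M L2 $ i $ j)"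
        by (rule sum.mono_neutral_right) (auto simp: u_def)
      also have "\<dots> = (\<Sum>r\<in>X. u $ \<sigma> r * ?M L2 $ \<sigma> r $ j)"
        by (simp add: sum.reindex[OF \<sigma>(1)])
      also have "\<dots> = (\<Sum>r\<in>set xs. y r * (H2 ** ?M L2) $ r $ j)"
        by (intro sum.cong) (auto simp: xs u H2)
      finally show ?thesis .
    qed
    then have "u = 0" using y by (intro L2(3)[rule_format]) (auto simp: u_def)
    then show "\<forall>r\<in>set xs. y r = 0"
      using u by (auto simp: xs Finite_Cartesian_Product.vec_eq_iff)
  qed
  \<comment> \<open>The first minor is nonzero at \<open>(L1, H1)\<close> and the second at
    \<open>(L2, H2)\<close>; some point between them serves both.\<close>
  let ?f = "\<lambda>rs \<theta>. minor (snd \<theta> ** ?M (fst \<theta>)) xs rs"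
  obtain t where t: "0 < t" "t < 1"
    "?f ss ((1 - t) *\<^sub>R (L1, H1) + t *\<^sub>R (L2, H2)) \<noteq> 0"
    "?f ts ((1 - t) *\<^sub>R (L1, H1) + t *\<^sub>R (L2, H2)) \<noteq> 0"
    "reg_det ((1 - t) *\<^sub>R (L1, H1) + t *\<^sub>R (L2, H2)) \<noteq> 0"
    by (rule regular_nonzero_on_line[of "?f ss" "(L1, H1)" "?f ts" "(L2, H2)"])
       (use nz1 nz2 L1(2) L2(2) regular_minor_mult_inv in \<open>auto simp: reg_det_def\<close>)
  define L where "L = (1 - t) *\<^sub>R L1 + t *\<^sub>R L2"
  define H where "H = (1 - t) *\<^sub>R H1 + t *\<^sub>R H2"
  let ?Om = "transpose H ** H"
  have LD: "L $ x $ y = 0" if "(x, y) \<notin> D" for x y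
    using that by (simp add: L_def L1 L2)
  have regL: "reg_det (L, Q) \<noteq> 0" for Q
    using t(5) by (simp add: L_def reg_det_def)
  have "(H ** ?M L) $ i $ j = 0" if "i \<notin> set xs" for i j
    using that by (simp add: H_def H1_def H2_def xs matrix_matrix_mult_def)
  then have "minor (transpose (H ** ?M L) ** (H ** ?M L)) ss ts \<noteq> 0"
    using t(3,4) by (intro minor_gram_nonzero[OF xs(2) ts len_xs]) (simp_all add: L_def H_def)
  then have nz: "minor (phi L ?Om) ss ts \<noteq> 0"
    by (simp add: phi_def matrix_transpose_mul matrix_mul_assoc)
  let ?g = "\<lambda>\<theta>. minor (phi (fst \<theta>) (snd \<theta>)) ss ts"
  \<comment> \<open>\<open>transpose H ** H\<close> is guaranteed only to be positive semidefinite.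
    Moving from it towards \<open>transpose H ** H + mat 1\<close> keeps the minor nonzero for some
    \<open>e > 0\<close> and makes the matrix positive definite.\<close>
  obtain e where e: "0 < e" "?g ((1 - e) *\<^sub>R (L, ?Om) + e *\<^sub>R (L, ?Om + mat 1)) \<noteq> 0"
    by (rule regular_nonzero_on_line[of ?g "(L, ?Om)" "\<lambda>_. 1" "(L, ?Om + mat 1)"])
       (use nz regL regular_minor_phi regular_const in auto)
  have line: "(1 - e) *\<^sub>R (L, ?Om) + e *\<^sub>R (L, ?Om + mat 1) = (L, ?Om + e *\<^sub>R mat 1)"
    by (simp add: algebra_simps)
  have "?Om + e *\<^sub>R mat 1 \<in> PDB B"
  proof -
    have "(?Om + e *\<^sub>R mat 1) $ x $ y = 0" if xy: "x \<noteq> y" "(x, y) \<notin> B" for x y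
    proof -
      \<comment> \<open>A row can couple only \<open>i\<close> with \<open>\<sigma> i\<close>, which
        are equal or joined by a bidirected edge; symmetry of \<open>B\<close> covers both
        orders.\<close>
      have "H $ i $ x * H $ i $ y = 0" for i
        using bspec[OF \<sigma>(2), of i] xy symD[OF B, of y x] by (auto simp: H_def H1_def H2_def)
      then have "?Om $ x $ y = 0"
        unfolding matrix_matrix_mult_def transpose_def vec_lambda_beta by (intro sum.neutral ballI)
      then show ?thesis using xy by (simp add: Finite_Cartesian_Product.mat_def)
    qed
    then show ?thesis using pos_def_gram_plus_scaled_id[OF e(1)] by (auto simp: PDB_def)
  qed
  then have "(L, ?Om + e *\<^sub>R mat 1) \<in> Theta D B" by (simp add: Theta_iff LD regL)
  then show thesis using that e(2) unfolding line by blast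
qed

section \<open>Removing edges into a vertex\<close>

text \<open>Exhibits an entry as a bilinear form in two columns of the inverse, so that changes of
  single columns can be followed.\<close>

lemma phi_entry:
  "phi L Om $ i $ j = column i (matrix_inv (mat 1 - L)) \<bullet> (Om *v column j (matrix_inv (mat 1 - L)))"
proof -
  let ?M = "matrix_inv (mat 1 - L)"
  have "phi L Om $ i $ j = (\<Sum>k\<in>UNIV. (\<Sum>a\<in>UNIV. ?M $ a $ i * Om $ a $ k) * ?M $ k $ j)"
    by (simp add: phi_def matrix_matrix_mult_def transpose_def)
  also have "\<dots> = (\<Sum>a\<in>UNIV. ?M $ a $ i * (\<Sum>k\<in>UNIV. Om $ a $ k * ?M $ k $ j))"
    by (simp add: sum_distrib_left sum_distrib_right mult.assoc) (rule sum.swap)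
  finally show ?thesis
    by (simp add: inner_vec_def matrix_vector_mult_def column_def)
qed

text \<open>Row vectors supported on the closed set of vertices reachable from \<^term>\<open>v\<close> form a subspace
  that is mapped injectively into itself, hence onto itself, by \<^term>\<open>mat 1 - L\<close>.\<close>

lemma matrix_inv_row_support:
  fixes L :: "real^'n::finite^'n"
  assumes LD: "\<And>x y. (x, y) \<notin> D \<Longrightarrow> L $ x $ y = 0" and det: "det (mat 1 - L) \<noteq> 0"
    and x: "x \<noteq> v" "x \<notin> des D v"
  shows "matrix_inv (mat 1 - L) $ v $ x = 0"
proof -
  let ?A = "mat 1 - L"
  let ?M = "matrix_inv ?A"
  let ?R = "insert v (des D v)"
  let ?f = "\<lambda>u. transpose ?A *v u"
  define W where "W = {u :: real^'n. \<forall>y. y \<notin> ?R \<longrightarrow> u $ y = 0}"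
  have inv: "invertible ?A" using det by (simp add: invertible_det_nz)
  have "transpose ?M ** transpose ?A = mat 1"
    by (simp only: matrix_transpose_mul[symmetric] invertible_matrix_inv[OF inv] transpose_mat)
  then have cancel: "transpose ?M *v ?f u = u" for u
    by (metis matrix_vector_mul_assoc matrix_vector_mul_lid)
  have W: "subspace W" by (auto simp: W_def subspace_def)
  have "?f u \<in> W" if u: "u \<in> W" for u
  proof -
    have "(\<Sum>k\<in>UNIV. ?A $ k $ y * u $ k) = 0" if y: "y \<notin> ?R" for y
    proof (rule sum.neutral, rule ballI)
      fix k
      show "?A $ k $ y * u $ k = 0"
      proof (cases "k \<in> ?R")
        case True
        then have "(k, y) \<notin> D" using y by (auto simp: des_def intro: trancl_into_trancl)
        then show ?thesis using True y LD[of k y] by (auto simp: Finite_Cartesian_Product.mat_def)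
      qed (use u in \<open>auto simp: W_def\<close>)
    qed
    then show ?thesis by (auto simp: W_def matrix_vector_mult_def transpose_def)
  qed
  then have "?f ` W \<subseteq> W" by blast
  moreover have "inj ?f" using cancel by (metis injI)
  then have "dim (?f ` W) = dim W"
    by (intro dim_image_eq[OF matrix_vector_mul_linear]) (auto intro: inj_on_subset)
  ultimately have "?f ` W = W"
    using W by (intro subspace_dim_equal linear_subspace_image[OF matrix_vector_mul_linear]) auto
  moreover have "axis v 1 \<in> W" by (auto simp: W_def axis_def)
  ultimately obtain u where u: "u \<in> W" "?f u = axis v 1" by (metis imageE)
  \<comment> \<open>The preimage of \<open>axis v 1\<close> is row \<open>v\<close> of the inverse,
    and membership in \<open>W\<close> is the claimed support.\<close>
  have "u = transpose ?M *v axis v 1" using cancel[of u] u(2) by simp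
  then have "u $ x = ?M $ v $ x"
    by (simp only: matrix_vector_mult_basis) (simp add: column_def transpose_def)
  then show ?thesis using u(1) x by (auto simp: W_def)
qed

text \<open>Removing edges into \<open>v\<close> adds the vector \<open>c\<close> to column
  \<open>v\<close> of \<open>I - L\<close>, a rank-one update. Columns of the inverse outside the
  closed descendants of \<open>v\<close> stay fixed because row \<open>v\<close> vanishes there, and
  column \<open>v\<close> loses the combination \<open>d\<close> of the parents' columns.\<close>

lemma phi_remove_incoming:
  fixes L Om :: "real^'n::finite^'n"
  assumes \<theta>: "(L, Om) \<in> Theta D B" and v: "v \<notin> des D v" and W: "\<And>x. x \<in> W \<Longrightarrow> (x, v) \<in> D"
  defines "L' \<equiv> \<chi> i j. if j = v \<and> i \<in> W then 0 else L $ i $ j"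
  shows "(L', Om) \<in> Theta (D - W \<times> {v}) B"
    and "\<And>i j. i \<notin> insert v (des D v) \<Longrightarrow> j \<notin> insert v (des D v) \<Longrightarrow>
      phi L' Om $ i $ j = phi L Om $ i $ j"
    and "\<And>i. i \<notin> insert v (des D v) \<Longrightarrow>
      phi L' Om $ i $ v = phi L Om $ i $ v - (\<Sum>x\<in>W. L $ x $ v * phi L Om $ i $ x)"
proof -
  let ?A = "mat 1 - L" and ?A' = "mat 1 - L'"
  let ?M = "matrix_inv ?A"
  have LD: "\<And>x y. (x, y) \<notin> D \<Longrightarrow> L $ x $ y = 0" and det: "det ?A \<noteq> 0" and Om: "Om \<in> PDB B"
    using \<theta> by (auto simp: Theta_iff reg_det_def)
  have inv: "invertible ?A" using det by (simp add: invertible_det_nz)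
  have row0: "?M $ v $ x = 0" if "x \<noteq> v" "x \<notin> des D v" for x
    using LD det that by (rule matrix_inv_row_support)
  \<comment> \<open>A parent of \<open>v\<close> that is \<open>v\<close> itself or a descendant of
    \<open>v\<close> would put \<open>v\<close> on a directed cycle.\<close>
  have vx: "?M $ v $ x = 0" if "(x, v) \<in> D" for x
  proof -
    have "x \<noteq> v" "x \<notin> des D v"
      using that v by (auto simp: des_def intro: trancl_into_trancl)
    then show ?thesis by (rule row0)
  qed
  have "(?M ** ?A) $ v $ v = ?M $ v $ v - (\<Sum>k\<in>UNIV. ?M $ v $ k * L $ k $ v)"
    by (simp add: matrix_matrix_mult_def Finite_Cartesian_Product.mat_def right_diff_distrib
        sum_subtractf if_distrib[of "\<lambda>x. _ * x"] cong: if_cong)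
  moreover have "(\<Sum>k\<in>UNIV. ?M $ v $ k * L $ k $ v) = 0"
  proof (rule sum.neutral, rule ballI)
    fix k show "?M $ v $ k * L $ k $ v = 0" using vx[of k] LD[of k v] by auto
  qed
  ultimately have vv: "?M $ v $ v = 1"
    unfolding invertible_matrix_inv(2)[OF inv] by (simp add: Finite_Cartesian_Product.mat_def)
  define c where "c = (\<chi> i. if i \<in> W then L $ i $ v else 0)"
  define d where "d = ?M *v c"
  have d: "d = (\<Sum>x\<in>W. L $ x $ v *\<^sub>R column x ?M)"
  proof -
    have "d $ i = (\<Sum>x\<in>W. L $ x $ v *\<^sub>R column x ?M) $ i" for i
      unfolding d_def matrix_vector_mult_def vec_lambda_beta sum_component
      by (rule sum.mono_neutral_cong_right) (auto simp: c_def column_def)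
    then show ?thesis by (simp add: Finite_Cartesian_Product.vec_eq_iff)
  qed
  have dv: "d $ v = 0"
    unfolding d sum_component by (rule sum.neutral) (auto simp: column_def vx W)
  have Ad: "?A *v d = c"
    by (simp add: d_def matrix_vector_mul_assoc invertible_matrix_inv[OF inv])
  have A': "?A' $ i $ k = ?A $ i $ k + (if k = v then c $ i else 0)" for i k
    by (simp add: L'_def c_def)
  have A'_mul: "(\<Sum>k\<in>UNIV. ?A' $ i $ k * y k) = (\<Sum>k\<in>UNIV. ?A $ i $ k * y k) + c $ i * y v" for i y
    unfolding A' by (simp add: distrib_right sum.distrib if_distrib[of "\<lambda>x. x * _"] cong: if_cong)
  \<comment> \<open>The Sherman-Morrison formula; its denominator \<open>1 + d $ v\<close> equals 1
    by \<open>dv\<close>.\<close>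
  define M' where "M' = (\<chi> i j. ?M $ i $ j - d $ i * ?M $ v $ j)"
  have "?A' ** M' = mat 1"
  proof -
    have "(?A' ** M') $ i $ j = mat 1 $ i $ j" for i j
    proof -
      have "(?A' ** M') $ i $ j = (\<Sum>k\<in>UNIV. ?A' $ i $ k * ?M $ k $ j) - (\<Sum>k\<in>UNIV. ?A' $ i $ k * d $ k) * ?M $ v $ j"
        by (simp add: matrix_matrix_mult_def M'_def right_diff_distrib sum_subtractf sum_distrib_right mult.assoc)
      also have "\<dots> = (?A ** ?M) $ i $ j + c $ i * ?M $ v $ j - ((?A *v d) $ i + c $ i * d $ v) * ?M $ v $ j"
        unfolding A'_mul by (simp add: matrix_matrix_mult_def matrix_vector_mult_def)
      also have "\<dots> = mat 1 $ i $ j"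
        by (simp add: Ad dv invertible_matrix_inv[OF inv])
      finally show ?thesis .
    qed
    then show ?thesis by (simp add: Finite_Cartesian_Product.vec_eq_iff)
  qed
  moreover from this have "M' ** ?A' = mat 1" by (simp add: matrix_left_right_inverse)
  ultimately have inv': "invertible ?A'" unfolding invertible_def by blast
  have M': "matrix_inv ?A' = M'"
    using invertible_matrix_inv(2)[OF inv'] \<open>?A' ** M' = mat 1\<close>
    by (metis matrix_mul_assoc matrix_mul_lid matrix_mul_rid)
  show "(L', Om) \<in> Theta (D - W \<times> {v}) B"
    using inv' LD Om by (auto simp: Theta_iff reg_det_def invertible_det_nz L'_def)
  have col: "column j M' = column j ?M - ?M $ v $ j *\<^sub>R d" for j
    by (simp add: Finite_Cartesian_Product.vec_eq_iff column_def M'_def)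
  have col_same: "column j M' = column j ?M" if "j \<notin> insert v (des D v)" for j
    using that row0[of j] by (simp add: col)
  show "phi L' Om $ i $ j = phi L Om $ i $ j"
    if "i \<notin> insert v (des D v)" "j \<notin> insert v (des D v)" for i j
    unfolding phi_entry M' col_same[OF that(1)] col_same[OF that(2)] ..
  show "phi L' Om $ i $ v = phi L Om $ i $ v - (\<Sum>x\<in>W. L $ x $ v * phi L Om $ i $ x)"
    if "i \<notin> insert v (des D v)" for i
  proof -
    have "phi L' Om $ i $ v = column i ?M \<bullet> (Om *v (column v ?M - d))"
      unfolding phi_entry M' by (simp add: col_same[OF that] col[of v] vv)
    also have "\<dots> = phi L Om $ i $ v - column i ?M \<bullet> (Om *v d)"
      by (simp add: phi_entry matrix_vector_mult_diff_distrib inner_diff_right)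
    also have "column i ?M \<bullet> (Om *v d) = (\<Sum>x\<in>W. L $ x $ v * phi L Om $ i $ x)"
      unfolding d by (simp add: phi_entry linear_sum[OF matrix_vector_mul_linear] o_def inner_sum_right
          matrix_vector_mult_scaleR)
    finally show ?thesis .
  qed
qed

text \<open>After the edges are removed, the small flow forces the minor on \<open>ts @ [v]\<close>
  to vanish. Expanding that minor along its modified last column gives a linear equation, which is
  solved for the coefficient of \<open>w 0\<close>.\<close>

lemma lambda_determinantal_formula:
  fixes L Om :: "real^'n::finite^'n" and w :: "nat \<Rightarrow> 'n"
  assumes edges: "\<forall>i\<le>l. (w i, v) \<in> D" and wdist: "inj_on w {0..l}"
    and len: "length ss = Suc (length ts)" and ss: "distinct ss" and ts: "distinct (ts @ [v])"
    and a: "des D v \<inter> (set ss \<union> set ts \<union> {v}) = {}" and v: "v \<notin> set ss"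
    and flow: "max_flow (flow_graph (D - {(w i, v) | i. i \<le> l}) B) (Inl ` set ss) (Inr ` (set ts \<union> {v}))
      < real (length ss)"
    and \<theta>: "(L, Om) \<in> Theta D B" and nz: "minor (phi L Om) ss (ts @ [w 0]) \<noteq> 0"
  shows "L $ w 0 $ v = (minor (phi L Om) ss (ts @ [v])
    - (\<Sum>i = 1..l. L $ w i $ v * minor (phi L Om) ss (ts @ [w i]))) / minor (phi L Om) ss (ts @ [w 0])"
proof -
  let ?W = "w ` {..l}"
  let ?m = "\<lambda>x. minor (phi L Om) ss (ts @ [x])"
  define L' where "L' = (\<chi> i j. if j = v \<and> i \<in> ?W then 0 else L $ i $ j)"
  have "v \<notin> des D v" using a by blast
  note rem = phi_remove_incoming[OF \<theta> this, of ?W, folded L'_def]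
  have "{(w i, v) | i. i \<le> l} = ?W \<times> {v}" by auto
  then have "minor (phi L' Om) ss (ts @ [v]) = 0"
    using max_flow_ge_if_minor_nonzero[OF rem(1) ss ts] flow edges len by force
  \<comment> \<open>Index 0 stands for the old column of \<open>v\<close> with coefficient 1, and
    \<open>Suc i\<close> for the column of \<open>w i\<close> with coefficient
    \<open>- L $ w i $ v\<close>.\<close>
  moreover have "minor (phi L' Om) ss (ts @ [v]) =
      (\<Sum>j\<in>{0..Suc l}. (case j of 0 \<Rightarrow> 1 | Suc i \<Rightarrow> - L $ w i $ v) * ?m (case j of 0 \<Rightarrow> v | Suc i \<Rightarrow> w i))"
  proof (rule minor_last_column_linear[OF len])
    have outside: "x \<notin> insert v (des D v)" if "x \<in> set ss \<union> set ts" for x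
      using that a v ts by auto
    fix r assume r: "r \<in> set ss"
    show "phi L' Om $ r $ x = phi L Om $ r $ x" if "x \<in> set ts" for x
      using r that edges by (intro rem(2) outside) auto
    have "phi L' Om $ r $ v = phi L Om $ r $ v - (\<Sum>x\<in>?W. L $ x $ v * phi L Om $ r $ x)"
      using r edges by (intro rem(3) outside) auto
    also have "(\<Sum>x\<in>?W. L $ x $ v * phi L Om $ r $ x) = (\<Sum>i\<in>{0..l}. L $ w i $ v * phi L Om $ r $ w i)"
      using sum.reindex[OF wdist] by (simp add: atLeast0AtMost)
    finally show "phi L' Om $ r $ v = (\<Sum>j\<in>{0..Suc l}. (case j of 0 \<Rightarrow> 1 | Suc i \<Rightarrow> - L $ w i $ v) *
        phi L Om $ r $ (case j of 0 \<Rightarrow> v | Suc i \<Rightarrow> w i))"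
      unfolding sum.atLeast0_atMost_Suc_shift by (simp add: sum_negf)
  qed
  ultimately have "?m v = (\<Sum>i\<in>{0..l}. L $ w i $ v * ?m (w i))"
    unfolding sum.atLeast0_atMost_Suc_shift by (simp add: sum_negf)
  also have "\<dots> = L $ w 0 $ v * ?m (w 0) + (\<Sum>i = 1..l. L $ w i $ v * ?m (w i))"
    by (simp add: sum.atLeast_Suc_atMost)
  finally show ?thesis using nz by (simp add: field_simps)
qed

section \<open>Identifiability\<close>

text \<open>The equation must hold at both parameters with the same image. The second may lie in the
  enlarged exceptional set, but membership in \<open>A\<close> depends on \<open>phi\<close> alone,
  so it avoids \<open>A\<close> together with the first.\<close>

lemma generically_identifiable_by_equation:
  fixes D B :: "('n::finite \<times> 'n) set" and F :: "nat \<Rightarrow> real^'n^'n \<Rightarrow> real"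
  assumes A: "proper_alg_subset D B A" and I: "finite I"
    and nz: "\<And>\<theta>. \<theta> \<in> Theta D B \<Longrightarrow> \<theta> \<in> A \<longleftrightarrow> N (phi (fst \<theta>) (snd \<theta>)) = 0"
    and eq: "\<And>L Om. (L, Om) \<in> Theta D B - A \<Longrightarrow>
      L $ u $ v = (G (phi L Om) - (\<Sum>i\<in>I. L $ w i $ v * F i (phi L Om))) / N (phi L Om)"
    and gen: "\<forall>i\<in>I. generically_identifiable D B (w i) v"
  shows "generically_identifiable D B u v"
proof -
  have "\<forall>i\<in>I. \<exists>A. proper_alg_subset D B A \<and> (\<forall>L Om L' Om'. (L, Om) \<in> Theta D B - A \<longrightarrow>
      (L', Om') \<in> Theta D B \<longrightarrow> phi L' Om' = phi L Om \<longrightarrow> L' $ w i $ v = L $ w i $ v)"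
    using gen by (simp add: generically_identifiable_def)
  then obtain C where "\<forall>i\<in>I. proper_alg_subset D B (C i) \<and> (\<forall>L Om L' Om'. (L, Om) \<in> Theta D B - C i \<longrightarrow>
      (L', Om') \<in> Theta D B \<longrightarrow> phi L' Om' = phi L Om \<longrightarrow> L' $ w i $ v = L $ w i $ v)"
    by (rule bchoice[THEN exE])
  then have C: "\<And>i. i \<in> I \<Longrightarrow> proper_alg_subset D B (C i)"
    "\<And>i L Om L' Om'. i \<in> I \<Longrightarrow> (L, Om) \<in> Theta D B - C i \<Longrightarrow> (L', Om') \<in> Theta D B \<Longrightarrow>
      phi L' Om' = phi L Om \<Longrightarrow> L' $ w i $ v = L $ w i $ v"
    by meson+
  obtain A' where A': "proper_alg_subset D B A'" "A \<union> (\<Union>i\<in>I. C i) \<subseteq> A'"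
    using proper_alg_subset_UN[OF I A, of C] C(1) by blast
  have "L' $ u $ v = L $ u $ v"
    if \<theta>: "(L, Om) \<in> Theta D B - A'" and \<theta>': "(L', Om') \<in> Theta D B" and phi: "phi L' Om' = phi L Om"
    for L Om L' Om'
  proof -
    have 1: "(L, Om) \<in> Theta D B - A" using \<theta> A'(2) by blast
    then have 2: "(L', Om') \<in> Theta D B - A" using nz[of "(L, Om)"] nz[of "(L', Om')"] \<theta>' phi by auto
    have "L' $ w i $ v = L $ w i $ v" if "i \<in> I" for i
      using \<theta> A'(2) that by (intro C(2)[OF that _ \<theta>' phi]) blast
    then show ?thesis unfolding eq[OF 1] eq[OF 2] phi by simp
  qed
  then show ?thesis unfolding generically_identifiable_def using A'(1) by blast
qed

lemma rationally_identifiable_by_equation: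
  fixes D B :: "('n::finite \<times> 'n) set" and F :: "nat \<Rightarrow> real^'n^'n \<Rightarrow> real"
  assumes A: "proper_alg_subset D B A" and I: "finite I"
    and nz: "\<And>\<theta>. \<theta> \<in> Theta D B \<Longrightarrow> \<theta> \<in> A \<longleftrightarrow> N (phi (fst \<theta>) (snd \<theta>)) = 0"
    and eq: "\<And>L Om. (L, Om) \<in> Theta D B - A \<Longrightarrow>
      L $ u $ v = (G (phi L Om) - (\<Sum>i\<in>I. L $ w i $ v * F i (phi L Om))) / N (phi L Om)"
    and poly: "N \<in> polyfun mat_coords" "G \<in> polyfun mat_coords" "\<And>i. F i \<in> polyfun mat_coords"
    and rat: "\<forall>i\<in>I. rationally_identifiable D B (w i) v"
  shows "rationally_identifiable D B u v"
proof -
  define R where "R i p q A \<longleftrightarrow> p \<in> polyfun mat_coords \<and> q \<in> polyfun mat_coords \<and> proper_alg_subset D B A \<and>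
    (\<forall>L Om. (L, Om) \<in> Theta D B - A \<longrightarrow>
      q (phi L Om) \<noteq> 0 \<and> p (phi L Om) / q (phi L Om) = L $ w i $ v)" for i p q A
  have "\<forall>i\<in>I. \<exists>p q A. R i p q A"
    using rat by (simp add: rationally_identifiable_def R_def)
  then obtain p where "\<forall>i\<in>I. \<exists>q A. R i (p i) q A" by (rule bchoice[THEN exE])
  then obtain q where "\<forall>i\<in>I. \<exists>A. R i (p i) (q i) A" by (rule bchoice[THEN exE])
  then obtain C where R: "\<forall>i\<in>I. R i (p i) (q i) (C i)" by (rule bchoice[THEN exE])
  have pq: "\<And>i. i \<in> I \<Longrightarrow> p i \<in> polyfun mat_coords" "\<And>i. i \<in> I \<Longrightarrow> q i \<in> polyfun mat_coords"
    and C: "\<And>i. i \<in> I \<Longrightarrow> proper_alg_subset D B (C i)"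
    and q0: "\<And>i L Om. i \<in> I \<Longrightarrow> (L, Om) \<in> Theta D B - C i \<Longrightarrow> q i (phi L Om) \<noteq> 0"
    and pq_eq: "\<And>i L Om. i \<in> I \<Longrightarrow> (L, Om) \<in> Theta D B - C i \<Longrightarrow>
      p i (phi L Om) / q i (phi L Om) = L $ w i $ v"
    using R by (simp_all add: R_def)
  obtain A' where A': "proper_alg_subset D B A'" "A \<union> (\<Union>i\<in>I. C i) \<subseteq> A'"
    using proper_alg_subset_UN[OF I A, of C] C by blast
  \<comment> \<open>\<open>P / Q\<close> is the right-hand side of the equation with
    \<open>p i / q i\<close> in place of the coefficient of \<open>w i\<close>, brought to the
    common denominator.\<close>
  define P where "P S = (\<Prod>i\<in>I. q i S) * G S - (\<Sum>i\<in>I. p i S * (\<Prod>j\<in>I - {i}. q j S) * F i S)" for S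
  define Q where "Q S = (\<Prod>i\<in>I. q i S) * N S" for S
  have "P \<in> polyfun mat_coords" "Q \<in> polyfun mat_coords"
    unfolding P_def[abs_def] Q_def[abs_def]
    by (intro polyfun_diff polyfun.mult polyfun_prod polyfun_sum pq poly; simp)+
  moreover have "Q (phi L Om) \<noteq> 0 \<and> P (phi L Om) / Q (phi L Om) = L $ u $ v"
    if \<theta>: "(L, Om) \<in> Theta D B - A'" for L Om
  proof -
    let ?S = "phi L Om"
    have \<theta>A: "(L, Om) \<in> Theta D B - A" using \<theta> A'(2) by blast
    have \<theta>C: "(L, Om) \<in> Theta D B - C i" if "i \<in> I" for i using \<theta> A'(2) that by blast
    have N: "N ?S \<noteq> 0" using nz[of "(L, Om)"] \<theta>A by auto
    have prod: "(\<Prod>i\<in>I. q i ?S) \<noteq> 0" using q0 \<theta>C I by simp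
    have "p i ?S * (\<Prod>j\<in>I - {i}. q j ?S) * F i ?S = (\<Prod>i\<in>I. q i ?S) * (L $ w i $ v * F i ?S)"
      if "i \<in> I" for i
      using q0[OF that \<theta>C[OF that]] unfolding pq_eq[OF that \<theta>C[OF that], symmetric] prod.remove[OF I that]
      by simp
    then have "(\<Sum>i\<in>I. p i ?S * (\<Prod>j\<in>I - {i}. q j ?S) * F i ?S) =
        (\<Sum>i\<in>I. (\<Prod>i\<in>I. q i ?S) * (L $ w i $ v * F i ?S))"
      by (rule sum.cong[OF refl])
    then have "P ?S = (\<Prod>i\<in>I. q i ?S) * (G ?S - (\<Sum>i\<in>I. L $ w i $ v * F i ?S))"
      by (simp only: P_def right_diff_distrib sum_distrib_left)
    then show ?thesis using eq[OF \<theta>A] N prod by (simp add: Q_def)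
  qed
  ultimately show ?thesis
    unfolding rationally_identifiable_def using A'(1)
    by (intro exI[of _ P] exI[of _ Q] exI[of _ A']) blast
qed

theorem theorem3p5:
  fixes D B :: "('n::finite \<times> 'n) set"
    and v :: 'n and w :: "nat \<Rightarrow> 'n" and l :: nat
    and S T :: "'n set" and k :: nat
    and ss ts :: "'n list"
  assumes G: "mixed_graph D B"
    and edges: "\<forall>i\<le>l. (w i, v) \<in> D"
    and wdist: "inj_on w {0..l}"
    and S_sub: "S \<subseteq> UNIV - {v}"
    and T_sub: "T \<subseteq> UNIV - {v, w 0}"
    and cardS: "card S = k" and cardT: "card T + 1 = k"
    and ss: "distinct ss" "set ss = S"
    and ts: "distinct ts" "set ts = T"
    and a: "des D v \<inter> (S \<union> T \<union> {v}) = {}"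
    and b: "max_flow (flow_graph D B) (Inl ` S) (Inr ` (T \<union> {w 0})) = real k"
    and c: "max_flow (flow_graph (D - {(w i, v) | i. i \<le> l}) B) (Inl ` S) (Inr ` (T \<union> {v}))
              < real k"
  shows
   "((\<forall>i\<in>{1..l}. generically_identifiable D B (w i) v) \<longrightarrow>
       generically_identifiable D B (w 0) v) \<and>
    ((\<forall>i\<in>{1..l}. rationally_identifiable D B (w i) v) \<longrightarrow>
       rationally_identifiable D B (w 0) v) \<and>
    (\<exists>A. proper_alg_subset D B A \<and>
       (\<forall>L Om. (L, Om) \<in> Theta D B - A \<longrightarrow>
          minor (phi L Om) ss (ts @ [w 0]) \<noteq> 0 \<and>
          L $ w 0 $ v =
            (minor (phi L Om) ss (ts @ [v])
              - (\<Sum>i = 1..l. L $ w i $ v * minor (phi L Om) ss (ts @ [w i])))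
            / minor (phi L Om) ss (ts @ [w 0])))"
proof -
  let ?N = "\<lambda>S. minor S ss (ts @ [w 0])"
  let ?A = "{\<theta> \<in> Theta D B. ?N (phi (fst \<theta>) (snd \<theta>)) = 0}"
  have len_ss: "length ss = k" and len: "length ss = Suc (length ts)"
    using distinct_card[OF ss(1)] distinct_card[OF ts(1)] ss(2) ts(2) cardS cardT by simp_all
  have "sym B" using G by (simp add: mixed_graph_def)
  moreover have "distinct (ts @ [w 0])" using ts T_sub by auto
  \<comment> \<open>Hypothesis \<open>b\<close> enters here: maximum flow \<open>k\<close> exceeds
    \<open>k - 1\<close>, which yields a parameter where the denominator is nonzero.\<close>
  ultimately obtain \<theta> where "\<theta> \<in> Theta D B" "?N (phi (fst \<theta>) (snd \<theta>)) \<noteq> 0"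
    by (rule minor_phi_not_identically_zero[OF _ ss(1)]) (use len len_ss b ss ts in auto)
  then have A: "proper_alg_subset D B ?A"
    by (intro proper_alg_subset_regular regular_minor_phi)
  have eq: "L $ w 0 $ v = (minor (phi L Om) ss (ts @ [v])
      - (\<Sum>i = 1..l. L $ w i $ v * minor (phi L Om) ss (ts @ [w i]))) / ?N (phi L Om)"
    if "(L, Om) \<in> Theta D B - ?A" for L Om
    using that a c S_sub T_sub ss ts len_ss
    by (intro lambda_determinantal_formula[OF edges wdist len]) auto
  have "generically_identifiable D B (w 0) v" if "\<forall>i\<in>{1..l}. generically_identifiable D B (w i) v"
    by (rule generically_identifiable_by_equation[OF A _ _ eq that]) auto
  moreover have "rationally_identifiable D B (w 0) v" if "\<forall>i\<in>{1..l}. rationally_identifiable D B (w i) v"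
    by (rule rationally_identifiable_by_equation[OF A _ _ eq _ _ _ that]) (auto intro: polyfun_minor)
  ultimately show ?thesis using A eq by (intro conjI impI exI[of _ ?A]) auto
qed

end
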